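(* Suppose that $f\in C^1(\mathbb{R})$ and that $f'$ is absolutely continuous with $f''$ locally in $L^1$. Suppose that there exists a constant $M>0$ such that $|f'(x)|\le M$ for all $x\in\mathbb{R}$. Assume further that, for some constant $\gamma\in\mathbb{R}$, $$\Gamma f(x)+h(x)\ge \gamma \quad\text{for almost all } x\in\mathbb{R},$$ $$f(y)-f(x)\le K+k(x-y)\quad\text{for all } y<x,$$ $$f(y)-f(x)\le L+\ell(y-x)\quad\text{for all } x<y.$$ Then $\mathrm{AC}(x,\varphi)\ge\gamma$ for each feasible policy $\varphi$ and each initial state $x\in\mathbb{R}$.
   Context: Parameters: $\mu\in\mathbb{R}$, $\sigma>0$, fixed costs $K\ge 0$, $L\ge 0$, proportional costs $k>0$, $\ell>0$; $\lambda=2\mu/\sigma^2$. Let $W$ be an $\{\mathcal{F}_t\}$-standard Brownian motion on a filtered probability space $(\Omega,\{\mathcal F_t\},\mathcal F,\mathbb P)$, and $X(t)=x+\mu t+\sigma W(t)$, $t\ge0$. Operator: $\Gamma f(x)=\frac12\sigma^2 f''(x)+\mu f'(x)$ at each $x$ where $f''(x)$ exists. Policies: a policy $\varphi=(Y_1,Y_2)$ is a pair of processes adapted to $\{\mathcal F_t\}$ whose paths are right continuous on $[0,\infty)$ with left limits on $(0,\infty)$ and nondecreasing, with the convention $Y_i(0-)=0$ (so a jump at time $0$ is allowed and $Y_i(0)\ge 0$). The inventory process is $Z(t)=X(t)+Y_1(t)-Y_2(t)$, with $Z(0-)=x$ the initial inventory level (initial state). A time $t\ge 0$ is an increasing point of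 $Y_i$ if $Y_i(s)-Y_i(t-)>0$ for each $s>t$; $N_i(t)$ is the cardinality of the set of increasing points of $Y_i$ in $[0,t]$. A policy is feasible if for every $t\ge 0$: $\mathbb E_x[Y_i(t)]<\infty$ for $i=1,2$; $\mathbb E_x[N_1(t)]<\infty$ when $K>0$; and $\mathbb E_x[N_2(t)]<\infty$ when $L>0$. Here $\mathbb E_x$ is expectation given $Z(0-)=x$. Long-run average cost: $$\mathrm{AC}(x,\varphi)=\limsup_{t\to\infty}\frac1t\,\mathbb E_x\Big[\int_0^t h(Z(s))\,ds+KN_1(t)+LN_2(t)+kY_1(t)+\ell Y_2(t)\Big],$$ with the convention $0\cdot\infty=0$. Standing assumption on $h:\mathbb R\to[0,\infty)$: $h$ is continuous and convex; there is $a\in\mathbb R$ such that $h$ is $C^2$ on $\mathbb R\setminus\{a\}$ and $h(a)=0$; $h'(x)<0$ for $x<a$ and $h'(x)>0$ for $x>a$; if $\lambda>0$ then $\int_{-\infty}^a|h'(y)|e^{\lambda(y-a)}dy<\infty$; if $\lambda<0$ then $\int_a^\infty|h'(y)|e^{\lambda(y-a)}dy<\infty$. *)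

theory Defs
  imports "HOL-Probability.Probability"
begin

section \<open>Locally absolutely continuous functions and the operator \<open>\<Gamma>\<close>\<close>

definition abs_continuous_interval :: "(real \<Rightarrow> real) \<Rightarrow> real \<Rightarrow> real \<Rightarrow> bool" where
  "abs_continuous_interval g b c \<longleftrightarrow>
     (\<forall>\<epsilon>>0. \<exists>\<delta>>0. \<forall>D :: (real \<times> real) set.
        finite D \<and> (\<forall>(u, v)\<in>D. b \<le> u \<and> u < v \<and> v \<le> c) \<and>
        disjoint_family_on (\<lambda>(u, v). {u<..<v}) D \<and> (\<Sum>(u, v)\<in>D. v - u) < \<delta>
        \<longrightarrow> (\<Sum>(u, v)\<in>D. \<bar>g v - g u\<bar>) < \<epsilon>)"

definition locally_abs_continuous :: "(real \<Rightarrow> real) \<Rightarrow> bool" where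
  "locally_abs_continuous g \<longleftrightarrow> (\<forall>b c. abs_continuous_interval g b c)"

text \<open>Only meaningful at points where the second derivative exists; uses of this operator carry
  that condition explicitly.\<close>

definition Gamma_op :: "real \<Rightarrow> real \<Rightarrow> (real \<Rightarrow> real) \<Rightarrow> real \<Rightarrow> real" where
  "Gamma_op \<mu> \<sigma> f x = 1/2 * \<sigma>\<^sup>2 * deriv (deriv f) x + \<mu> * deriv f x"

section \<open>Holding cost\<close>

text \<open>In the last two conditions \<open>2 * \<mu> / \<sigma>\<^sup>2\<close> is the parameter \<open>\<lambda>\<close>; since \<open>h\<close> need not
  be differentiable at \<open>a\<close>, the endpoint is left out of the integrals.\<close>

definition holding_cost :: "real \<Rightarrow> real \<Rightarrow> (real \<Rightarrow> real) \<Rightarrow> bool" where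
  "holding_cost \<mu> \<sigma> h \<longleftrightarrow>
     (\<forall>x. 0 \<le> h x) \<and> continuous_on UNIV h \<and> convex_on UNIV h \<and>
     (\<exists>a. h C1_differentiable_on (- {a}) \<and> deriv h C1_differentiable_on (- {a}) \<and> h a = 0 \<and>
        (\<forall>x<a. deriv h x < 0) \<and> (\<forall>x>a. 0 < deriv h x) \<and>
        (let lam = 2 * \<mu> / \<sigma>\<^sup>2 in
          (lam > 0 \<longrightarrow>
             (\<integral>\<^sup>+y\<in>{..<a}. ennreal (\<bar>deriv h y\<bar> * exp (lam * (y - a))) \<partial>lborel) < \<infinity>) \<and>
          (lam < 0 \<longrightarrow>
             (\<integral>\<^sup>+y\<in>{a<..}. ennreal (\<bar>deriv h y\<bar> * exp (lam * (y - a))) \<partial>lborel) < \<infinity>)))"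

section \<open>Brownian motion on a filtered probability space\<close>

text \<open>Time is \<open>[0,\<infinity>)\<close>: processes and filtrations are indexed by \<^typ>\<open>real\<close>, and their values
  at negative times are never constrained or used. The filtration is not assumed to be complete
  or right continuous.\<close>

definition filtered_prob_space :: "'a measure \<Rightarrow> (real \<Rightarrow> 'a measure) \<Rightarrow> bool" where
  "filtered_prob_space P F \<longleftrightarrow>
     prob_space P \<and> (\<forall>t\<ge>0. subalgebra P (F t)) \<and>
     (\<forall>s t. 0 \<le> s \<and> s \<le> t \<longrightarrow> subalgebra (F t) (F s))"

definition adapted_process :: "(real \<Rightarrow> 'a measure) \<Rightarrow> (real \<Rightarrow> 'a \<Rightarrow> real) \<Rightarrow> bool" where
  "adapted_process F Y \<longleftrightarrow> (\<forall>t\<ge>0. Y t \<in> borel_measurable (F t))"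

definition standard_BM ::
    "'a measure \<Rightarrow> (real \<Rightarrow> 'a measure) \<Rightarrow> (real \<Rightarrow> 'a \<Rightarrow> real) \<Rightarrow> bool" where
  "standard_BM P F W \<longleftrightarrow>
     adapted_process F W \<and>
     (AE \<omega> in P. W 0 \<omega> = 0) \<and>
     (\<forall>\<omega>\<in>space P. continuous_on {0..} (\<lambda>t. W t \<omega>)) \<and>
     (\<forall>s t. 0 \<le> s \<and> s < t \<longrightarrow>
        distributed P lborel (\<lambda>\<omega>. W t \<omega> - W s \<omega>) (normal_density 0 (sqrt (t - s))) \<and>
        prob_space.indep_set P (sets (F s))
          {(\<lambda>\<omega>. W t \<omega> - W s \<omega>) -` B \<inter> space P | B. B \<in> sets borel})"

section \<open>Policies, inventory process and long-run average cost\<close>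

text \<open>With the convention \<open>Y (0-) = 0\<close>, monotonicity of the path on \<open>{0-} \<union> [0,\<infinity>)\<close> amounts to
  monotonicity on \<open>[0,\<infinity>)\<close> together with \<open>0 \<le> Y 0\<close>.\<close>

definition control_process ::
    "'a measure \<Rightarrow> (real \<Rightarrow> 'a measure) \<Rightarrow> (real \<Rightarrow> 'a \<Rightarrow> real) \<Rightarrow> bool" where
  "control_process P F Y \<longleftrightarrow>
     adapted_process F Y \<and>
     (\<forall>\<omega>\<in>space P.
        (\<forall>t\<ge>0. continuous (at_right t) (\<lambda>s. Y s \<omega>)) \<and>
        (\<forall>t>0. \<exists>l. ((\<lambda>s. Y s \<omega>) \<longlongrightarrow> l) (at_left t)) \<and>
        mono_on {0..} (\<lambda>s. Y s \<omega>) \<and> 0 \<le> Y 0 \<omega>)"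

definition left_value :: "(real \<Rightarrow> real) \<Rightarrow> real \<Rightarrow> real" where
  "left_value y t = (if t = 0 then 0 else Lim (at_left t) y)"

definition increasing_point :: "(real \<Rightarrow> real) \<Rightarrow> real \<Rightarrow> bool" where
  "increasing_point y t \<longleftrightarrow> 0 \<le> t \<and> (\<forall>s>t. y s - left_value y t > 0)"

text \<open>Counting measure, so that infinite sets of increasing points have cardinality \<open>\<infinity>\<close>.\<close>

definition num_increasing :: "(real \<Rightarrow> real) \<Rightarrow> real \<Rightarrow> ennreal" where
  "num_increasing y t = emeasure (count_space UNIV) {s\<in>{0..t}. increasing_point y s}"

type_synonym 'a policy = "(real \<Rightarrow> 'a \<Rightarrow> real) \<times> (real \<Rightarrow> 'a \<Rightarrow> real)"

definition is_policy :: "'a measure \<Rightarrow> (real \<Rightarrow> 'a measure) \<Rightarrow> 'a policy \<Rightarrow> bool" where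
  "is_policy P F \<phi> \<longleftrightarrow> control_process P F (fst \<phi>) \<and> control_process P F (snd \<phi>)"

definition feasible_policy ::
    "'a measure \<Rightarrow> (real \<Rightarrow> 'a measure) \<Rightarrow> real \<Rightarrow> real \<Rightarrow> 'a policy \<Rightarrow> bool" where
  "feasible_policy P F K L \<phi> \<longleftrightarrow>
     is_policy P F \<phi> \<and>
     (\<forall>t\<ge>0.
        (\<integral>\<^sup>+\<omega>. ennreal (fst \<phi> t \<omega>) \<partial>P) < \<infinity> \<and>
        (\<integral>\<^sup>+\<omega>. ennreal (snd \<phi> t \<omega>) \<partial>P) < \<infinity> \<and>
        (K > 0 \<longrightarrow> (\<integral>\<^sup>+\<omega>. num_increasing (\<lambda>s. fst \<phi> s \<omega>) t \<partial>P) < \<infinity>) \<and>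
        (L > 0 \<longrightarrow> (\<integral>\<^sup>+\<omega>. num_increasing (\<lambda>s. snd \<phi> s \<omega>) t \<partial>P) < \<infinity>))"

definition inventory ::
    "real \<Rightarrow> real \<Rightarrow> (real \<Rightarrow> 'a \<Rightarrow> real) \<Rightarrow> real \<Rightarrow> 'a policy \<Rightarrow> real \<Rightarrow> 'a \<Rightarrow> real" where
  "inventory \<mu> \<sigma> W x \<phi> t \<omega> = (x + \<mu> * t + \<sigma> * W t \<omega>) + fst \<phi> t \<omega> - snd \<phi> t \<omega>"

text \<open>All cost terms are nonnegative, so the expectation is a \<^typ>\<open>ennreal\<close>-valued integral
  (where \<open>0 * \<infinity> = 0\<close>); the result is an \<^typ>\<open>ereal\<close>, to be comparable with negative reals.\<close>

definition AC ::
    "'a measure \<Rightarrow> real \<Rightarrow> real \<Rightarrow> (real \<Rightarrow> 'a \<Rightarrow> real) \<Rightarrow> real \<Rightarrow> real \<Rightarrow> real \<Rightarrow> real \<Rightarrow>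
     (real \<Rightarrow> real) \<Rightarrow> real \<Rightarrow> 'a policy \<Rightarrow> ereal" where
  "AC P \<mu> \<sigma> W K L k l h x \<phi> =
     Limsup at_top (\<lambda>t::real. ereal (1 / t) * enn2ereal
       (\<integral>\<^sup>+\<omega>. (\<integral>\<^sup>+s\<in>{0..t}. ennreal (h (inventory \<mu> \<sigma> W x \<phi> s \<omega>)) \<partial>lborel)
          + ennreal K * num_increasing (\<lambda>s. fst \<phi> s \<omega>) t
          + ennreal L * num_increasing (\<lambda>s. snd \<phi> s \<omega>) t
          + ennreal (k * fst \<phi> t \<omega>) + ennreal (l * snd \<phi> t \<omega>) \<partial>P))"

end

theory Submission
  imports Defs
begin

text \<open>
  The classical argument applies Ito's formula to \<open>f (Z t)\<close> and takes expectations: the drift is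
  bounded below by \<open>\<gamma> - h\<close>, and each control action decreases \<open>f\<close> by at most its cost. Hence
  \<open>E f (Z t)\<close> plus the expected cost up to \<open>t\<close> is at least \<open>f x + \<gamma> * t\<close>, and dividing by \<open>t\<close> gives the
  claim once \<open>E f (Z t)\<close> is controlled. The proof below keeps this idea but avoids stochastic integration
  and estimates of the growth of \<open>E f (Z t)\<close>, in two moves.

  \<^emph>\<open>Localisation.\<close> Replace \<open>f'\<close> by \<open>\<theta> * f'\<close> with a slowly decaying unimodal cutoff \<open>\<theta>\<close>, and let \<open>F\<close> be
  an antiderivative. The jump inequalities survive with unchanged constants, by the second mean value theorem
  (\<open>unimodal_cutoff_jump_bound\<close>). As \<open>f'\<close> is bounded, the cutoff changes \<open>\<Gamma>\<close> only by an arbitrarily small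
  \<open>\<epsilon>\<close>; and as \<open>h \<ge> \<gamma>\<close> far out, the running cost can be truncated to a bounded uniformly continuous function
  below \<open>h\<close> (\<open>ex_bounded_subsolution\<close>). Since \<open>F\<close> is bounded, \<open>E F (Z t) / t\<close> tends to \<open>0\<close> for free. The almost
  everywhere inequality for \<open>f''\<close> is used only in integrated form, through
  \<open>abs_continuous_le_of_AE_slope_nonneg\<close>.

  \<^emph>\<open>Discretisation.\<close> Over a short time step of length \<open>\<delta>\<close>, the displacement of the inventory is that of the
  uncontrolled diffusion plus the net control. A one-sided second order expansion
  (\<open>second_order_lower_bound\<close>) and the moments of an independent Gaussian increment show that the diffusion
  changes \<open>E F\<close> by at least \<open>- \<delta> * E G\<close> up to \<open>o(\<delta>)\<close>, uniformly in the position; the net control decreases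
  \<open>F\<close> by at most its proportional cost plus at most one fixed cost for each control that is active in the step
  (\<open>controlled_step\<close>). A monotone path that increases during a step has an increasing point there
  (\<open>increasing_point_between\<close>), so the fixed costs charged on the grid never exceed the true ones. Summing
  over the grid, replacing the Riemann sum by the time integral (\<open>mean_G_modulus\<close>) and refining
  yields the inequality that Ito's formula would give.
\<close>

section \<open>Absolutely continuous functions with nonnegative slope\<close>

text \<open>
  The form in which products with Lipschitz cutoffs and added linear terms are seen to be
  absolutely continuous: their increments are dominated by those of \<open>g\<close> plus a multiple of the
  length of the interval.
\<close>

lemma abs_continuous_interval_perturb:
  assumes "abs_continuous_interval g b c"
    and le: "\<And>u v. b \<le> u \<Longrightarrow> u < v \<Longrightarrow> v \<le> c \<Longrightarrow> \<bar>w v - w u\<bar> \<le> \<bar>g v - g u\<bar> + C * (v - u)"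
  shows "abs_continuous_interval w b c"
  unfolding abs_continuous_interval_def
proof (intro allI impI)
  fix e :: real assume "e > 0"
  then obtain d where "d > 0" and d: "\<And>D. finite D \<Longrightarrow> (\<forall>(u, v)\<in>D. b \<le> u \<and> u < v \<and> v \<le> c) \<Longrightarrow>
      disjoint_family_on (\<lambda>(u, v). {u<..<v}) D \<Longrightarrow> (\<Sum>(u, v)\<in>D. v - u) < d \<Longrightarrow>
      (\<Sum>(u, v)\<in>D. \<bar>g v - g u\<bar>) < e / 2"
    using assms(1)[unfolded abs_continuous_interval_def, rule_format, of "e/2"] by auto
  define d' where "d' = min d (e / (2 * (\<bar>C\<bar> + 1)))"
  have "d' > 0" using \<open>d > 0\<close> \<open>e > 0\<close> by (simp add: d'_def)
  show "\<exists>\<delta>>0. \<forall>D. finite D \<and> (\<forall>(u, v)\<in>D. b \<le> u \<and> u < v \<and> v \<le> c) \<and>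
      disjoint_family_on (\<lambda>(u, v). {u<..<v}) D \<and> (\<Sum>(u, v)\<in>D. v - u) < \<delta> \<longrightarrow>
      (\<Sum>(u, v)\<in>D. \<bar>w v - w u\<bar>) < e"
  proof (intro exI[of _ d'] conjI allI impI \<open>d' > 0\<close>; elim conjE)
    fix D assume D: "finite D" "\<forall>(u, v)\<in>D. b \<le> u \<and> u < v \<and> v \<le> c"
      "disjoint_family_on (\<lambda>(u, v). {u<..<v}) D" "(\<Sum>(u, v)\<in>D. v - u) < d'"
    have len: "0 \<le> (\<Sum>(u, v)\<in>D. v - u)" using D(2) by (intro sum_nonneg) auto
    have "(\<Sum>(u, v)\<in>D. \<bar>w v - w u\<bar>) \<le> (\<Sum>(u, v)\<in>D. \<bar>g v - g u\<bar> + C * (v - u))"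
      using D(2) le by (intro sum_mono) auto
    also have "\<dots> = (\<Sum>(u, v)\<in>D. \<bar>g v - g u\<bar>) + C * (\<Sum>(u, v)\<in>D. v - u)"
      by (simp add: case_prod_unfold sum.distrib sum_distrib_left)
    also have "\<dots> < e / 2 + e / 2"
    proof (rule add_less_le_mono)
      show "(\<Sum>(u, v)\<in>D. \<bar>g v - g u\<bar>) < e / 2"
        using D by (intro d) (auto simp: d'_def)
      have "C * (\<Sum>(u, v)\<in>D. v - u) \<le> (\<bar>C\<bar> + 1) * (e / (2 * (\<bar>C\<bar> + 1)))"
        using D(4) len by (intro mult_mono) (auto simp: d'_def)
      also have "\<dots> = e / 2" by (simp add: field_simps)
      finally show "C * (\<Sum>(u, v)\<in>D. v - u) \<le> e / 2" .
    qed
    finally show "(\<Sum>(u, v)\<in>D. \<bar>w v - w u\<bar>) < e" by simp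
  qed
qed

text \<open>
  The part of the fundamental theorem of calculus for absolutely continuous functions that is needed
  below. Cover the exceptional null set by an open set \<open>T\<close> of small measure and choose a gauge that
  is contained in \<open>T\<close> at exceptional points and witnesses the slope bound at all others. In a fine
  tagged division of \<open>[b, c]\<close>, the intervals with exceptional tags have small total length, so by
  absolute continuity they contribute little to \<open>g c - g b\<close>; every other interval contributes at
  least \<open>- e\<close> times its length. Only a lower bound on difference quotients is assumed, because the
  lemma is applied to products with a cutoff that is not differentiable everywhere.
\<close>

lemma abs_continuous_le_of_AE_slope_nonneg:
  fixes g :: "real \<Rightarrow> real"
  assumes ac: "abs_continuous_interval g b c" and "b \<le> c"
    and slope: "AE x in lborel. b \<le> x \<longrightarrow> x \<le> c \<longrightarrow> (\<forall>e>0. \<forall>\<^sub>F y in at x. (g y - g x) / (y - x) > - e)"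
  shows "g b \<le> g c"
proof (rule field_le_epsilon)
  fix e' :: real assume "e' > 0"
  define e where "e = e' / (c - b + 1)"
  have "e > 0" using \<open>e' > 0\<close> \<open>b \<le> c\<close> by (simp add: e_def)
  obtain d where "d > 0" and d: "\<And>D. finite D \<Longrightarrow> (\<forall>(u, v)\<in>D. b \<le> u \<and> u < v \<and> v \<le> c) \<Longrightarrow>
      disjoint_family_on (\<lambda>(u, v). {u<..<v}) D \<Longrightarrow> (\<Sum>(u, v)\<in>D. v - u) < d \<Longrightarrow>
      (\<Sum>(u, v)\<in>D. \<bar>g v - g u\<bar>) < e"
    using ac[unfolded abs_continuous_interval_def, rule_format, of e] \<open>e > 0\<close> by auto
  obtain N where N: "N \<in> null_sets lborel"
    and notN: "\<And>x. x \<notin> N \<Longrightarrow> b \<le> x \<Longrightarrow> x \<le> c \<Longrightarrow> \<forall>\<^sub>F y in at x. (g y - g x) / (y - x) > - e"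
    using slope \<open>e > 0\<close> by (elim AE_E3) auto
  have "N \<in> null_sets lebesgue" using N by (rule null_sets_completionI)
  then have "N \<in> sets lebesgue" by blast
  then obtain T where T: "open T" "N \<subseteq> T" "emeasure lebesgue (T - N) < ennreal d"
    using sets_lebesgue_outer_open[OF _ \<open>d > 0\<close>] by metis
  have "emeasure lebesgue T = emeasure lebesgue (T - N)"
    using \<open>N \<in> null_sets lebesgue\<close> T(1) by (subst emeasure_Diff_null_set) auto
  then have Td: "emeasure lborel T < ennreal d" using T by simp
  have "\<exists>r>0. (x \<in> N \<longrightarrow> ball x r \<subseteq> T) \<and>
      (x \<notin> N \<and> b \<le> x \<and> x \<le> c \<longrightarrow> (\<forall>y. y \<noteq> x \<and> dist y x < r \<longrightarrow> (g y - g x) / (y - x) > - e))" for x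
  proof (cases "x \<in> N")
    case True
    then obtain r where "r > 0" "ball x r \<subseteq> T" using T openE by blast
    then show ?thesis using True by blast
  next
    case False
    then show ?thesis using notN[OF False] unfolding eventually_at
      by (cases "b \<le> x \<and> x \<le> c") (auto intro: exI[of _ 1])
  qed
  then obtain r where r: "\<And>x. r x > 0" "\<And>x. x \<in> N \<Longrightarrow> ball x (r x) \<subseteq> T"
    "\<And>x y. x \<notin> N \<Longrightarrow> b \<le> x \<Longrightarrow> x \<le> c \<Longrightarrow> y \<noteq> x \<Longrightarrow> dist y x < r x \<Longrightarrow> (g y - g x) / (y - x) > - e"
    by metis
  have "gauge (\<lambda>x. ball x (r x))" using r(1) by (intro gauge_ball_dependent) auto
  then obtain p where p: "p tagged_division_of {b..c}" "(\<lambda>x. ball x (r x)) fine p"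
    using fine_division_exists_real by blast
  have fin: "finite p" using p(1) by blast
  have K: "\<exists>u v. K = {u..v} \<and> u \<le> x \<and> x \<le> v \<and> b \<le> u \<and> v \<le> c \<and> {u..v} \<subseteq> ball x (r x)"
    if xK: "(x, K) \<in> p" for x K
  proof -
    obtain u v where uv: "K = cbox u v" using tagged_division_ofD(4)[OF p(1) xK] by blast
    have "x \<in> K" using tagged_division_ofD(2)[OF p(1) xK] .
    moreover have "K \<subseteq> {b..c}" using tagged_division_ofD(3)[OF p(1) xK] .
    moreover have "K \<subseteq> ball x (r x)" using fineD[OF p(2) xK] .
    ultimately show ?thesis using uv by auto
  qed
  \<comment> \<open>The intervals with exceptional tags; degenerate ones are dropped, so that an interval
    determines its tag and \<open>J\<close> is injective.\<close>
  define q where "q = {xK \<in> p. fst xK \<in> N \<and> Inf (snd xK) < Sup (snd xK)}"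
  define J where "J = (\<lambda>xK :: real \<times> real set. (Inf (snd xK), Sup (snd xK)))"
  have qp: "q \<subseteq> p" "finite q" using fin by (auto simp: q_def)
  have disj: "{Inf (snd a)<..<Sup (snd a)} \<inter> {Inf (snd a')<..<Sup (snd a')} = {}"
    if aa: "a \<in> q" "a' \<in> q" "a \<noteq> a'" for a a'
  proof -
    obtain u v u' v' where "snd a = {u..v}" "u \<le> v" "snd a' = {u'..v'}" "u' \<le> v'"
      using K[of "fst a" "snd a"] K[of "fst a'" "snd a'"] aa qp by force
    moreover have "interior (snd a) \<inter> interior (snd a') = {}"
      using tagged_division_ofD(5)[OF p(1), of "fst a" "snd a" "fst a'" "snd a'"] aa qp
      by (cases a; cases a') auto
    ultimately show ?thesis by simp
  qed
  have inj: "inj_on J q"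
  proof (rule inj_onI, rule ccontr)
    fix a a' assume a: "a \<in> q" "a' \<in> q" "J a = J a'" "a \<noteq> a'"
    have "Inf (snd a) < Sup (snd a)" using a(1) by (simp add: q_def)
    then show False using disj[OF a(1,2,4)] a(3) by (auto simp: J_def)
  qed
  have small: "(\<Sum>(u, v)\<in>J ` q. \<bar>g v - g u\<bar>) < e"
  proof (rule d)
    show "finite (J ` q)" using qp by simp
    show "\<forall>(u, v)\<in>J ` q. b \<le> u \<and> u < v \<and> v \<le> c"
    proof safe
      fix u v x L assume "(u, v) = J (x, L)" "(x, L) \<in> q"
      then show "b \<le> u" "u < v" "v \<le> c"
        using K[of x L] qp by (auto simp: J_def q_def)
    qed
    show dj: "disjoint_family_on (\<lambda>(u, v). {u<..<v}) (J ` q)"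
      unfolding disjoint_family_on_def
    proof (intro ballI impI)
      fix I I' assume "I \<in> J ` q" "I' \<in> J ` q" "I \<noteq> I'"
      then obtain a a' where "a \<in> q" "a' \<in> q" "I = J a" "I' = J a'" "a \<noteq> a'" by blast
      then show "(\<lambda>(u, v). {u<..<v}) I \<inter> (\<lambda>(u, v). {u<..<v}) I' = {}"
        using disj[of a a'] by (simp add: J_def)
    qed
    have "ennreal (\<Sum>(u, v)\<in>J ` q. v - u) = (\<Sum>(u, v)\<in>J ` q. ennreal (v - u))"
      using K qp by (subst sum_ennreal[symmetric]) (auto simp: J_def q_def case_prod_unfold)
    also have "\<dots> = (\<Sum>I\<in>J ` q. emeasure lborel ((\<lambda>(u, v). {u<..<v}) I))"
      by (rule sum.cong) (auto simp: J_def q_def)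
    also have "\<dots> = emeasure lborel (\<Union>I\<in>J ` q. (\<lambda>(u, v). {u<..<v}) I)"
      using dj qp by (intro sum_emeasure) auto
    also have "\<dots> \<le> emeasure lborel T"
    proof (rule emeasure_mono)
      show "(\<Union>I\<in>J ` q. (\<lambda>(u, v). {u<..<v}) I) \<subseteq> T"
      proof (rule UN_least)
        fix I assume "I \<in> J ` q"
        then obtain x L where xL: "(x, L) \<in> q" "I = J (x, L)" by auto
        then have "(x, L) \<in> p" using qp by blast
        then obtain u v where L: "L = {u..v}" "u \<le> x" "x \<le> v" "{u..v} \<subseteq> ball x (r x)"
          using K by blast
        moreover have "x \<in> N" using xL by (simp add: q_def)
        ultimately have "{u..v} \<subseteq> T" using r(2) by blast
        then show "(\<lambda>(u, v). {u<..<v}) I \<subseteq> T"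
          using L xL(2) by (auto simp: J_def)
      qed
    qed (use T in auto)
    also have "\<dots> < ennreal d" by (rule Td)
    finally show "(\<Sum>(u, v)\<in>J ` q. v - u) < d"
      by (meson ennreal_leI not_le)
  qed
  have step: "- e * (Sup L - Inf L) - (if (x, L) \<in> q then \<bar>g (Sup L) - g (Inf L)\<bar> else 0)
      \<le> g (Sup L) - g (Inf L)" if xL: "(x, L) \<in> p" for x L
  proof -
    obtain u v where uv: "L = {u..v}" "u \<le> x" "x \<le> v" "{u..v} \<subseteq> ball x (r x)"
      and bc: "b \<le> x" "x \<le> c"
      using K[OF xL] order_trans by blast
    show ?thesis
    proof (cases "x \<in> N")
      case True
      have "0 \<le> e * (v - u)" using \<open>e > 0\<close> uv by simp
      with True show ?thesis using uv xL
        by (cases "u = v") (auto simp: q_def)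
    next
      case False
      have "u \<in> {u..v}" "v \<in> {u..v}" using uv(2,3) by simp_all
    then have "u \<in> ball x (r x)" "v \<in> ball x (r x)" using uv(4) by blast+
      then have near: "dist u x < r x" "dist v x < r x" by (auto simp: dist_commute)
      have "- e * (v - x) \<le> g v - g x"
        using r(3)[OF False bc _ near(2)] uv by (cases "v = x") (auto simp: field_simps)
      moreover have "- e * (x - u) \<le> g x - g u"
        using r(3)[OF False bc _ near(1)] uv by (cases "u = x") (auto simp: field_simps)
      ultimately have "- e * (v - u) \<le> g v - g u" by (simp add: algebra_simps)
      then show ?thesis using uv False by (simp add: q_def)
    qed
  qed
  have "- e * (c - b) - (\<Sum>(u, v)\<in>J ` q. \<bar>g v - g u\<bar>)
      = - e * (\<Sum>(x, L)\<in>p. Sup L - Inf L)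
        - (\<Sum>(x, L)\<in>p. if (x, L) \<in> q then \<bar>g (Sup L) - g (Inf L)\<bar> else 0)"
  proof -
    have "(\<Sum>(x, L)\<in>p. Sup L - Inf L) = c - b"
      using additive_tagged_division_1[OF \<open>b \<le> c\<close> p(1), of "\<lambda>x. x"] by simp
    moreover have "(\<Sum>(u, v)\<in>J ` q. \<bar>g v - g u\<bar>) = (\<Sum>(x, L)\<in>q. \<bar>g (Sup L) - g (Inf L)\<bar>)"
      by (subst sum.reindex[OF inj]) (auto simp: J_def case_prod_unfold)
    moreover have "(\<Sum>(x, L)\<in>p. if (x, L) \<in> q then \<bar>g (Sup L) - g (Inf L)\<bar> else 0)
        = (\<Sum>(x, L)\<in>q. \<bar>g (Sup L) - g (Inf L)\<bar>)"
      using fin qp by (intro sum.mono_neutral_cong_right) (auto split: prod.splits)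
    ultimately show ?thesis by simp
  qed
  also have "\<dots> = (\<Sum>(x, L)\<in>p. - e * (Sup L - Inf L)
      - (if (x, L) \<in> q then \<bar>g (Sup L) - g (Inf L)\<bar> else 0))"
    by (subst sum_distrib_left) (simp add: case_prod_unfold sum_subtractf[symmetric])
  also have "\<dots> \<le> (\<Sum>(x, L)\<in>p. g (Sup L) - g (Inf L))"
  proof (rule sum_mono)
    fix a assume "a \<in> p"
    then show "(case a of (x, L) \<Rightarrow> - e * (Sup L - Inf L)
        - (if (x, L) \<in> q then \<bar>g (Sup L) - g (Inf L)\<bar> else 0))
      \<le> (case a of (x, L) \<Rightarrow> g (Sup L) - g (Inf L))"
      using step[of "fst a" "snd a"] by (simp only: case_prod_unfold prod.collapse)
  qed
  also have "\<dots> = g c - g b"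
    by (rule additive_tagged_division_1[OF \<open>b \<le> c\<close> p(1)])
  finally have "g b \<le> g c + e * (c - b + 1)" using small by (simp add: algebra_simps)
  moreover have "e * (c - b + 1) = e'" using \<open>b \<le> c\<close> by (simp add: e_def)
  ultimately show "g b \<le> g c + e'" by simp
qed

section \<open>Real functions: moduli, one-sided expansions, cutoffs\<close>

text \<open>
  Uniform continuity and boundedness in one estimate: \<open>\<eta>\<close> covers nearby points, and for points at
  least \<open>d\<close> apart the constant \<open>C = 2 * B / d\<close> suffices, where \<open>B\<close> bounds \<open>\<bar>p\<bar>\<close>. A bound that is affine in
  \<open>\<bar>x - y\<bar>\<close> can be integrated against random displacements of which only moments are known.
\<close>

lemma compact_support_modulus:
  fixes p :: "real \<Rightarrow> real"
  assumes cont: "continuous_on UNIV p" and "R > 0" and supp: "\<And>x. \<bar>x\<bar> \<ge> R \<Longrightarrow> p x = 0" and "\<eta> > 0"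
  shows "\<exists>C\<ge>0. \<forall>x y. \<bar>p x - p y\<bar> \<le> \<eta> + C * \<bar>x - y\<bar>"
proof -
  have c: "continuous_on {-R..R} p" using cont continuous_on_subset by blast
  have "uniformly_continuous_on {-R..R} p"
    using compact_uniformly_continuous[OF c] by simp
  then obtain d where "d > 0" and d: "\<And>x y. x \<in> {-R..R} \<Longrightarrow> y \<in> {-R..R} \<Longrightarrow> dist y x < d \<Longrightarrow>
      dist (p y) (p x) < \<eta>"
    using \<open>\<eta> > 0\<close> unfolding uniformly_continuous_on_def by metis
  have "bounded (p ` {-R..R})"
    using compact_continuous_image[OF c] compact_imp_bounded by blast
  then obtain B where "B > 0" and B: "\<And>x. x \<in> {-R..R} \<Longrightarrow> \<bar>p x\<bar> \<le> B"
    unfolding bounded_pos by auto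
  define cl where "cl x = max (- R) (min R x)" for x :: real
  have cl: "p (cl x) = p x" "cl x \<in> {-R..R}" "\<bar>cl x - cl y\<bar> \<le> \<bar>x - y\<bar>" for x y
    using \<open>R > 0\<close> supp by (auto simp: cl_def max_def min_def)
  have "\<bar>p x - p y\<bar> \<le> \<eta> + (2 * B / d) * \<bar>x - y\<bar>" for x y
  proof (cases "\<bar>x - y\<bar> < d")
    case True
    then have "dist (p (cl x)) (p (cl y)) < \<eta>"
      using cl(3)[of x y] by (intro d cl) (auto simp: dist_real_def)
    moreover have "0 \<le> (2 * B / d) * \<bar>x - y\<bar>" using \<open>B > 0\<close> \<open>d > 0\<close> by simp
    ultimately show ?thesis by (simp add: dist_real_def cl)
  next
    case False
    have "\<bar>p x - p y\<bar> \<le> 2 * B"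
      using B[OF cl(2)[of x]] B[OF cl(2)[of y]] by (simp add: cl)
    also have "\<dots> = (2 * B / d) * d" using \<open>d > 0\<close> by simp
    also have "\<dots> \<le> (2 * B / d) * \<bar>x - y\<bar>"
      using False \<open>B > 0\<close> \<open>d > 0\<close> by (intro mult_left_mono) auto
    finally show ?thesis using \<open>\<eta> > 0\<close> by simp
  qed
  then show ?thesis using \<open>B > 0\<close> \<open>d > 0\<close> by (intro exI[of _ "2 * B / d"]) auto
qed

text \<open>
  A one-sided Taylor expansion for a function whose derivative \<open>u\<close> is not differentiable but
  satisfies, in integrated form, the differential inequality \<open>u' \<ge> - c * q\<close>. The difference of the
  two sides, as a function of \<open>r\<close>, vanishes at \<open>0\<close> and is nonincreasing to the left and
  nondecreasing to the right of \<open>0\<close>. This replaces Ito's formula.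
\<close>

lemma second_order_lower_bound:
  fixes F u q :: "real \<Rightarrow> real"
  assumes F': "\<And>x. (F has_real_derivative u x) (at x)"
    and slope: "\<And>x y m. x \<le> y \<Longrightarrow> (\<And>s. x \<le> s \<Longrightarrow> s \<le> y \<Longrightarrow> q s \<le> m) \<Longrightarrow> u y - u x \<ge> - c * m * (y - x)"
    and q: "\<And>x y. \<bar>q x - q y\<bar> \<le> \<eta> + C * (x - y)\<^sup>2" and "C \<ge> 0" "c \<ge> 0"
  shows "F (z + r) \<ge> F z + r * u z - c * (r\<^sup>2 / 2 * (q z + \<eta>) + C * r ^ 4 / 4)"
proof -
  define D where "D r = F (z + r) - F z - r * u z + c * (r\<^sup>2 / 2 * (q z + \<eta>) + C * r ^ 4 / 4)" for r
  have D': "(D has_real_derivative (u (z + r) - u z + c * (q z + \<eta> + C * r\<^sup>2) * r)) (at r)" for r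
  proof -
    have "((\<lambda>r. F (z + r)) has_real_derivative u (z + r)) (at r)"
      using F'[of "z + r"] DERIV_shift[of F "u (z + r)" r z] by (simp add: add.commute)
    then show ?thesis unfolding D_def
      by (auto intro!: derivative_eq_intros simp: algebra_simps eval_nat_numeral)
  qed
  have bound: "q s \<le> q z + \<eta> + C * t\<^sup>2" if "\<bar>s - z\<bar> \<le> \<bar>t\<bar>" for s t
  proof -
    have "(s - z)\<^sup>2 \<le> t\<^sup>2" using that by (simp add: abs_le_square_iff)
    then have "C * (s - z)\<^sup>2 \<le> C * t\<^sup>2" using \<open>C \<ge> 0\<close> by (rule mult_left_mono)
    then show ?thesis using q[of s z] by linarith
  qed
  have "D 0 \<le> D r"
  proof (cases "r \<ge> 0")
    case True
    show ?thesis
    proof (rule DERIV_nonneg_imp_nondecreasing[OF True])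
      fix t :: real assume "0 \<le> t"
      have "u (z + t) - u z \<ge> - c * (q z + \<eta> + C * t\<^sup>2) * (z + t - z)"
        using \<open>0 \<le> t\<close> by (intro slope bound) auto
      then show "\<exists>y. DERIV D t :> y \<and> 0 \<le> y" using D'[of t] by (intro exI conjI) auto
    qed
  next
    case False
    then have "r \<le> 0" by simp
    then show ?thesis
    proof (rule DERIV_nonpos_imp_nonincreasing)
      fix t :: real assume "t \<le> 0"
      have "u z - u (z + t) \<ge> - c * (q z + \<eta> + C * t\<^sup>2) * (z - (z + t))"
        using \<open>t \<le> 0\<close> by (intro slope bound) auto
      then show "\<exists>y. DERIV D t :> y \<and> y \<le> 0" using D'[of t] by (intro exI conjI) auto
    qed
  qed
  then show ?thesis by (simp add: D_def)
qed

text \<open>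
  The second mean value theorem for integrals, applied to \<open>F' = \<theta> * f'\<close> with \<open>\<theta>\<close> monotone.
\<close>

lemma second_mean_value_antiderivative:
  fixes F f \<theta> v :: "real \<Rightarrow> real"
  assumes "a \<le> b" and f': "\<And>x. (f has_real_derivative v x) (at x)"
    and F': "\<And>x. (F has_real_derivative (\<theta> x * v x)) (at x)"
    and mono: "mono_on {a..b} \<theta> \<or> antimono_on {a..b} \<theta>"
  obtains c where "a \<le> c" "c \<le> b" "F b - F a = \<theta> a * (f c - f a) + \<theta> b * (f b - f c)"
proof -
  have fI: "(v has_integral f y - f x) {x..y}" if "x \<le> y" for x y
    using that f' by (intro fundamental_theorem_of_calculus)
      (auto simp: has_real_derivative_iff_has_vector_derivative[symmetric] intro: has_field_derivative_at_within)
  have FI: "((\<lambda>x. \<theta> x * v x) has_integral F b - F a) {a..b}"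
    using \<open>a \<le> b\<close> F' by (intro fundamental_theorem_of_calculus)
      (auto simp: has_real_derivative_iff_has_vector_derivative[symmetric] intro: has_field_derivative_at_within)
  have vint: "v integrable_on {a..b}" using fI \<open>a \<le> b\<close> by blast
  have *: "integral {a..c} v = f c - f a" "integral {c..b} v = f b - f c" if "c \<in> {a..b}" for c
    using fI that by (auto intro: integral_unique)
  from mono show ?thesis
  proof
    assume "mono_on {a..b} \<theta>"
    then obtain c where c: "c \<in> {a..b}"
      "((\<lambda>x. \<theta> x * v x) has_integral (\<theta> a * integral {a..c} v + \<theta> b * integral {c..b} v)) {a..b}"
      using second_mean_value_theorem_full[OF vint \<open>a \<le> b\<close>, of \<theta>] unfolding mono_on_def by auto
    then show ?thesis using has_integral_unique[OF FI c(2)] * that by auto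
  next
    assume "antimono_on {a..b} \<theta>"
    then obtain c where c: "c \<in> {a..b}"
      "((\<lambda>x. - \<theta> x * v x) has_integral (- \<theta> a * integral {a..c} v + - \<theta> b * integral {c..b} v)) {a..b}"
      using second_mean_value_theorem_full[OF vint \<open>a \<le> b\<close>, of "\<lambda>x. - \<theta> x"]
      unfolding monotone_on_def by auto
    have "((\<lambda>x. - \<theta> x * v x) has_integral - (F b - F a)) {a..b}"
      using has_integral_neg[OF FI] by simp
    from has_integral_unique[OF this c(2)]
    have "F b - F a = \<theta> a * (f c - f a) + \<theta> b * (f b - f c)"
      using *[OF c(1)] by simp
    then show ?thesis using that c(1) by auto
  qed
qed

text \<open>
  Multiplying the derivative by a unimodal cutoff with values in \<open>[0, 1]\<close> preserves the one-sided
  jump bound with the same constants. Indeed \<open>\<theta>\<close> is a mixture of indicators of intervals around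
  \<open>0\<close>, so \<open>F x - F y\<close> is a subconvex combination of differences \<open>f x' - f y'\<close> with
  \<open>x \<le> x' \<le> y' \<le> y\<close>. Instead of the mixture, the proof takes the intermediate points from the second
  mean value theorem, on each side of \<open>0\<close> separately.
\<close>

lemma unimodal_cutoff_jump_bound:
  fixes F f \<theta> v :: "real \<Rightarrow> real"
  assumes f': "\<And>x. (f has_real_derivative v x) (at x)"
    and F': "\<And>x. (F has_real_derivative (\<theta> x * v x)) (at x)"
    and \<theta>: "\<And>x. 0 \<le> \<theta> x" "\<And>x. \<theta> x \<le> 1" "mono_on {..0} \<theta>" "antimono_on {0..} \<theta>"
    and "\<kappa> \<ge> 0" "\<beta> \<ge> 0" and jump: "\<And>x y. x < y \<Longrightarrow> f x - f y \<le> \<kappa> + \<beta> * (y - x)"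
    and "x < y"
  shows "F x - F y \<le> \<kappa> + \<beta> * (y - x)"
proof -
  define m where "m = \<kappa> + \<beta> * (y - x)"
  have "m \<ge> 0" using assms by (simp add: m_def)
  have J: "w * (f a - f b) \<le> w * m" if "0 \<le> w" "x \<le> a" "a \<le> b" "b \<le> y" for w a b
  proof (rule mult_left_mono)
    have "\<beta> * (b - a) \<le> \<beta> * (y - x)" using that \<open>\<beta> \<ge> 0\<close> by (intro mult_left_mono) auto
    then show "f a - f b \<le> m"
      using jump[of a b] that \<open>m \<ge> 0\<close> by (cases "a = b") (auto simp: m_def)
  qed (rule that)
  have one: "w * m \<le> m" if "w \<le> 1" for w
    using mult_right_mono[OF that \<open>m \<ge> 0\<close>] by simp
  consider "0 \<le> x" | "y \<le> 0" | "x < 0" "0 < y" by linarith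
  then have "F x - F y \<le> m"
  proof cases
    case 1
    have "antimono_on {x..y} \<theta>" using 1 by (intro monotone_on_subset[OF \<theta>(4)]) auto
    then obtain c where c: "x \<le> c" "c \<le> y" "F y - F x = \<theta> x * (f c - f x) + \<theta> y * (f y - f c)"
      using second_mean_value_antiderivative[OF less_imp_le[OF \<open>x < y\<close>] f' F'] by blast
    have d: "\<theta> y \<le> \<theta> x" using \<theta>(4) 1 \<open>x < y\<close> by (auto simp: monotone_on_def)
    have "F x - F y = (\<theta> x - \<theta> y) * (f x - f c) + \<theta> y * (f x - f y)"
      using c(3) by (simp add: algebra_simps)
    also have "\<dots> \<le> (\<theta> x - \<theta> y) * m + \<theta> y * m"
      using c d \<theta>(1) \<open>x < y\<close> by (intro add_mono J) auto
    also have "\<dots> = \<theta> x * m" by (simp add: algebra_simps)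
    also have "\<dots> \<le> m" by (rule one[OF \<theta>(2)])
    finally show ?thesis .
  next
    case 2
    have "mono_on {x..y} \<theta>" using 2 by (intro monotone_on_subset[OF \<theta>(3)]) auto
    then obtain c where c: "x \<le> c" "c \<le> y" "F y - F x = \<theta> x * (f c - f x) + \<theta> y * (f y - f c)"
      using second_mean_value_antiderivative[OF less_imp_le[OF \<open>x < y\<close>] f' F'] by blast
    have d: "\<theta> x \<le> \<theta> y" using \<theta>(3) 2 \<open>x < y\<close> by (auto simp: monotone_on_def)
    have "F x - F y = \<theta> x * (f x - f y) + (\<theta> y - \<theta> x) * (f c - f y)"
      using c(3) by (simp add: algebra_simps)
    also have "\<dots> \<le> \<theta> x * m + (\<theta> y - \<theta> x) * m"
      using c d \<theta>(1) \<open>x < y\<close> by (intro add_mono J) auto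
    also have "\<dots> = \<theta> y * m" by (simp add: algebra_simps)
    also have "\<dots> \<le> m" by (rule one[OF \<theta>(2)])
    finally show ?thesis .
  next
    case 3
    have "mono_on {x..0} \<theta>" by (intro monotone_on_subset[OF \<theta>(3)]) auto
    then obtain c where c: "x \<le> c" "c \<le> 0" "F 0 - F x = \<theta> x * (f c - f x) + \<theta> 0 * (f 0 - f c)"
      using second_mean_value_antiderivative[OF less_imp_le[OF \<open>x < 0\<close>] f' F'] by blast
    have "antimono_on {0..y} \<theta>" by (intro monotone_on_subset[OF \<theta>(4)]) auto
    then obtain d where d: "0 \<le> d" "d \<le> y" "F y - F 0 = \<theta> 0 * (f d - f 0) + \<theta> y * (f y - f d)"
      using second_mean_value_antiderivative[OF less_imp_le[OF \<open>0 < y\<close>] f' F'] by blast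
    have x0: "\<theta> x \<le> \<theta> 0" using \<theta>(3) 3 by (auto simp: monotone_on_def)
    have y0: "\<theta> y \<le> \<theta> 0" using \<theta>(4) 3 by (auto simp: monotone_on_def)
    have "F x - F y \<le> \<theta> 0 * m"
    proof (cases "\<theta> x \<le> \<theta> y")
      case True
      have "F x - F y = \<theta> x * (f x - f y) + (\<theta> 0 - \<theta> y) * (f c - f d) + (\<theta> y - \<theta> x) * (f c - f y)"
        using c(3) d(3) by (simp add: algebra_simps)
      also have "\<dots> \<le> \<theta> x * m + (\<theta> 0 - \<theta> y) * m + (\<theta> y - \<theta> x) * m"
        using c d x0 y0 \<theta>(1) \<open>x < y\<close> 3 True by (intro add_mono J) auto
      finally show ?thesis by (simp add: algebra_simps)
    next
      case False
      have "F x - F y = \<theta> y * (f x - f y) + (\<theta> 0 - \<theta> x) * (f c - f d) + (\<theta> x - \<theta> y) * (f x - f d)"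
        using c(3) d(3) by (simp add: algebra_simps)
      also have "\<dots> \<le> \<theta> y * m + (\<theta> 0 - \<theta> x) * m + (\<theta> x - \<theta> y) * m"
        using c d x0 y0 \<theta>(1) \<open>x < y\<close> 3 False by (intro add_mono J) auto
      finally show ?thesis by (simp add: algebra_simps)
    qed
    also have "\<dots> \<le> m" by (rule one[OF \<theta>(2)])
    finally show ?thesis .
  qed
  then show ?thesis by (simp add: m_def)
qed

section \<open>Localisation of the test function\<close>

text \<open>
  \<open>F\<close> is a bounded function with \<open>\<Gamma> F + G \<ge> 0\<close> that satisfies both jump inequalities; \<open>u\<close> is its
  derivative. As \<open>u\<close> need not be differentiable, the differential inequality
  \<open>\<sigma>\<^sup>2 / 2 * u' + \<mu> * u + G \<ge> 0\<close> is stated as a lower bound on the increments of \<open>u\<close> over intervals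
  on which \<open>\<mu> * u + G\<close> is bounded above by a constant.
\<close>

locale bounded_subsolution =
  fixes \<mu> \<sigma> K L k l :: real and F u G :: "real \<Rightarrow> real" and B :: real
  assumes pos: "\<sigma> > 0" "K \<ge> 0" "L \<ge> 0"
    and F': "\<And>x. (F has_real_derivative u x) (at x)"
    and cont: "continuous_on UNIV u" "continuous_on UNIV G"
    and bounded: "\<And>x. \<bar>F x\<bar> \<le> B" "\<And>x. \<bar>u x\<bar> \<le> B" "\<And>x. \<bar>G x\<bar> \<le> B"
    and modulus: "\<And>\<eta>. \<eta> > 0 \<Longrightarrow> \<exists>C\<ge>0. \<forall>x y. \<bar>u x - u y\<bar> \<le> \<eta> + C * \<bar>x - y\<bar>"
      "\<And>\<eta>. \<eta> > 0 \<Longrightarrow> \<exists>C\<ge>0. \<forall>x y. \<bar>G x - G y\<bar> \<le> \<eta> + C * \<bar>x - y\<bar>"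
    and slope: "\<And>x y m. x \<le> y \<Longrightarrow> (\<And>s. x \<le> s \<Longrightarrow> s \<le> y \<Longrightarrow> \<mu> * u s + G s \<le> m) \<Longrightarrow>
      u y - u x \<ge> - (2 / \<sigma>\<^sup>2) * m * (y - x)"
    and up: "\<And>x y. x < y \<Longrightarrow> F x - F y \<le> K + k * (y - x)"
    and down: "\<And>x y. x < y \<Longrightarrow> F y - F x \<le> L + l * (y - x)"

definition cutoff :: "real \<Rightarrow> real \<Rightarrow> real" where
  "cutoff n x = max 0 (min 1 (2 - \<bar>x\<bar> / n))"

lemma cutoff:
  assumes "n > 0"
  shows "0 \<le> cutoff n x" "cutoff n x \<le> 1" "\<bar>x\<bar> \<le> n \<Longrightarrow> cutoff n x = 1" "\<bar>x\<bar> \<ge> 2 * n \<Longrightarrow> cutoff n x = 0"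
    "mono_on {..0} (cutoff n)" "antimono_on {0..} (cutoff n)" "continuous_on S (cutoff n)"
    "\<bar>cutoff n x - cutoff n y\<bar> \<le> \<bar>x - y\<bar> / n"
proof -
  show "0 \<le> cutoff n x" "cutoff n x \<le> 1" by (auto simp: cutoff_def)
  show "\<bar>x\<bar> \<le> n \<Longrightarrow> cutoff n x = 1" "\<bar>x\<bar> \<ge> 2 * n \<Longrightarrow> cutoff n x = 0"
    using assms by (auto simp: cutoff_def min_def max_def field_simps)
  have *: "cutoff n a \<le> cutoff n b" if "\<bar>b\<bar> \<le> \<bar>a\<bar>" for a b
  proof -
    have "\<bar>b\<bar> / n \<le> \<bar>a\<bar> / n" using that assms by (intro divide_right_mono) auto
    then show ?thesis by (auto simp: cutoff_def)
  qed
  show "mono_on {..0} (cutoff n)" "antimono_on {0..} (cutoff n)"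
    by (auto intro!: monotone_onI *)
  show "continuous_on S (cutoff n)"
    unfolding cutoff_def using assms by (intro continuous_intros) auto
  have clip: "\<bar>max 0 (min 1 (2 - s)) - max 0 (min 1 (2 - t))\<bar> \<le> \<bar>s - t\<bar>" for s t :: real
    by (auto simp: min_def max_def)
  have "\<bar>cutoff n x - cutoff n y\<bar> \<le> \<bar>\<bar>x\<bar> / n - \<bar>y\<bar> / n\<bar>"
    unfolding cutoff_def by (rule clip)
  also have "\<dots> = \<bar>\<bar>x\<bar> - \<bar>y\<bar>\<bar> / n" using assms by (simp add: diff_divide_distrib[symmetric])
  also have "\<dots> \<le> \<bar>x - y\<bar> / n" using assms by (intro divide_right_mono) auto
  finally show "\<bar>cutoff n x - cutoff n y\<bar> \<le> \<bar>x - y\<bar> / n" .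
qed

text \<open>
  Outside \<open>[-R, R]\<close> the function is constant on each side.
\<close>

lemma bounded_of_compactly_supported_derivative:
  fixes F u :: "real \<Rightarrow> real"
  assumes F': "\<And>x. (F has_real_derivative u x) (at x)" and supp: "\<And>x. \<bar>x\<bar> \<ge> R \<Longrightarrow> u x = 0" and "R > 0"
  shows "\<exists>B. \<forall>x. \<bar>F x\<bar> \<le> B"
proof -
  have c: "continuous_on {-R..R} F"
    using F' by (intro DERIV_continuous_on) (auto intro: has_field_derivative_at_within)
  have "bounded (F ` {-R..R})"
    using compact_continuous_image[OF c] compact_imp_bounded by blast
  then obtain B where "\<forall>y\<in>F ` {-R..R}. norm y \<le> B" unfolding bounded_iff by blast
  then have B: "\<bar>F x\<bar> \<le> B" if "x \<in> {-R..R}" for x using that by auto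
  have const: "\<exists>c. \<forall>x\<in>S. F x = c" if "convex S" and S: "\<And>x. x \<in> S \<Longrightarrow> \<bar>x\<bar> \<ge> R" for S
    using F' supp[OF S] by (intro has_field_derivative_zero_constant[OF \<open>convex S\<close>])
      (metis has_field_derivative_at_within)
  have "\<exists>c. \<forall>x\<in>{R..}. F x = c" "\<exists>c. \<forall>x\<in>{..-R}. F x = c" by (auto intro!: const)
  then obtain c d where c: "\<And>x. x \<ge> R \<Longrightarrow> F x = c" and d: "\<And>x. x \<le> - R \<Longrightarrow> F x = d" by auto
  have "\<bar>F x\<bar> \<le> B" for x
  proof -
    consider "x \<ge> R" | "x \<le> - R" | "x \<in> {-R..R}" by fastforce
    then show ?thesis
    proof cases
      case 1
      then show ?thesis using c[of x] c[of R] B[of R] \<open>R > 0\<close> by simp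
    next
      case 2
      then show ?thesis using d[of x] d[of "-R"] B[of "-R"] \<open>R > 0\<close> by simp
    qed (rule B)
  qed
  then show ?thesis by blast
qed

text \<open>
  If \<open>g' \<ge> - m\<close> almost everywhere, then the lower derivative of \<open>\<theta> * g\<close> is at least
  \<open>- \<theta> * m - \<beta> * M\<close>: the cutoff varies at rate at most \<open>\<beta>\<close> and multiplies a function bounded by \<open>M\<close>.
\<close>

lemma abs_continuous_truncation_slope:
  fixes g \<theta> q :: "real \<Rightarrow> real"
  assumes ac: "\<And>b c. abs_continuous_interval g b c"
    and g: "\<And>x. \<bar>g x\<bar> \<le> M"
    and \<theta>: "\<And>x. 0 \<le> \<theta> x" "\<And>x. \<theta> x \<le> 1" "\<And>x y. \<bar>\<theta> x - \<theta> y\<bar> \<le> \<beta> * \<bar>x - y\<bar>"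
    and ae: "AE x in lborel. g differentiable (at x) \<and> - m x \<le> deriv g x"
    and "x \<le> y" and m: "\<And>s. x \<le> s \<Longrightarrow> s \<le> y \<Longrightarrow> \<theta> s * m s + \<beta> * M \<le> m'"
  shows "- m' * (y - x) \<le> \<theta> y * g y - \<theta> x * g x"
proof -
  have "M \<ge> 0" using g(1)[of 0] by linarith
  have "\<beta> \<ge> 0" using \<theta>(3)[of 1 0] by simp
  define w where "w s = \<theta> s * g s + m' * s" for s
  have arith: "- e < X" if "X = A + E + m'" "- T - S \<le> A" "S \<le> 1 * (e / 2)" "\<bar>E\<bar> \<le> U" "T + U \<le> m'" "0 < e"
    for X A E T S U e :: real
    using that by linarith
  have "abs_continuous_interval w x y"
  proof (rule abs_continuous_interval_perturb[OF ac])
    fix s t :: real assume "s < t"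
    have "w t - w s = \<theta> t * (g t - g s) + g s * (\<theta> t - \<theta> s) + m' * (t - s)"
      by (simp add: w_def algebra_simps)
    moreover have "\<bar>\<theta> t * (g t - g s)\<bar> \<le> \<bar>g t - g s\<bar>"
      using mult_right_mono[OF \<theta>(2)[of t], of "\<bar>g t - g s\<bar>"] \<theta>(1)[of t] by (simp add: abs_mult)
    moreover have "\<bar>g s * (\<theta> t - \<theta> s)\<bar> \<le> M * (\<beta> * (t - s))"
      using \<theta>(3)[of t s] \<open>s < t\<close> \<open>M \<ge> 0\<close> unfolding abs_mult by (intro mult_mono g) auto
    moreover have "\<bar>m' * (t - s)\<bar> = \<bar>m'\<bar> * (t - s)" using \<open>s < t\<close> by (simp add: abs_mult)
    ultimately have "\<bar>w t - w s\<bar> \<le> \<bar>g t - g s\<bar> + M * (\<beta> * (t - s)) + \<bar>m'\<bar> * (t - s)" by linarith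
    then show "\<bar>w t - w s\<bar> \<le> \<bar>g t - g s\<bar> + (M * \<beta> + \<bar>m'\<bar>) * (t - s)"
      by (simp add: algebra_simps)
  qed
  then have "w x \<le> w y"
  proof (rule abs_continuous_le_of_AE_slope_nonneg[OF _ \<open>x \<le> y\<close>])
    have slope_s: "\<forall>\<^sub>F t in at s. (w t - w s) / (t - s) > - e"
      if s: "g differentiable (at s)" "- m s \<le> deriv g s" "x \<le> s" "s \<le> y" and "e > 0" for s e :: real
    proof -
      have "((\<lambda>t. (g t - g s) / (t - s)) \<longlongrightarrow> deriv g s) (at s)"
        using s(1) DERIV_deriv_iff_real_differentiable has_field_derivative_iff by blast
      then have "\<forall>\<^sub>F t in at s. (g t - g s) / (t - s) > - m s - e / 2"
        using s(2) \<open>e > 0\<close> by (intro order_tendstoD) auto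
      moreover have "\<forall>\<^sub>F t in at s. t \<noteq> s" by (simp add: eventually_at_filter)
      ultimately show ?thesis
      proof eventually_elim
        case (elim t)
        have "w t - w s = \<theta> s * (g t - g s) + g t * (\<theta> t - \<theta> s) + m' * (t - s)"
          by (simp add: w_def algebra_simps)
        then have "(w t - w s) / (t - s) = \<theta> s * ((g t - g s) / (t - s)) + g t * ((\<theta> t - \<theta> s) / (t - s)) + m'"
          using elim(2) by (simp add: add_divide_distrib)
        moreover have "\<theta> s * (- m s - e / 2) \<le> \<theta> s * ((g t - g s) / (t - s))"
          using elim(1) \<theta>(1) by (intro mult_left_mono) auto
        then have "- (\<theta> s * m s) - \<theta> s * (e / 2) \<le> \<theta> s * ((g t - g s) / (t - s))"
          by (simp add: right_diff_distrib)
        moreover have "\<theta> s * (e / 2) \<le> 1 * (e / 2)" using \<open>e > 0\<close> \<theta>(2) by (intro mult_right_mono) auto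
        moreover have "\<bar>g t * ((\<theta> t - \<theta> s) / (t - s))\<bar> \<le> M * \<beta>"
          using \<theta>(3)[of t s] elim(2) \<open>M \<ge> 0\<close> unfolding abs_mult
          by (intro mult_mono g) (auto simp: abs_divide field_simps)
        moreover have "\<theta> s * m s + M * \<beta> \<le> m'" using m[OF s(3,4)] by (simp add: mult.commute)
        ultimately show ?case using \<open>e > 0\<close> by (rule arith)
      qed
    qed
    show "AE s in lborel. x \<le> s \<longrightarrow> s \<le> y \<longrightarrow> (\<forall>e>0. \<forall>\<^sub>F t in at s. (w t - w s) / (t - s) > - e)"
      using ae by (rule eventually_mono) (use slope_s in blast)
  qed
  then show ?thesis by (simp add: w_def algebra_simps)
qed

text \<open>
  Localisation of \<open>f\<close>. The derivative of \<open>F\<close> is \<open>\<theta> * f'\<close>, where \<open>\<theta>\<close> is \<open>1\<close> on \<open>[-n, n]\<close> and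
  decays to \<open>0\<close> over a further length \<open>n\<close>. Then
  \<open>\<Gamma> F \<ge> \<theta> * \<Gamma> f - \<sigma>\<^sup>2 * M / (2 * n) \<ge> \<theta> * (\<gamma> - h) - \<epsilon>\<close> for \<open>n\<close> large, so that \<open>G = \<theta> * (h - \<gamma>) + \<epsilon>\<close> will
  do. As \<open>h \<ge> \<gamma>\<close> where \<open>\<theta> < 1\<close>, the truncated running cost \<open>\<gamma> - \<epsilon> + G\<close> is still at most \<open>h\<close>.
\<close>

lemma ex_bounded_subsolution:
  fixes f h :: "real \<Rightarrow> real"
  assumes pos: "\<sigma> > 0" "K \<ge> 0" "L \<ge> 0" "k > 0" "l > 0"
    and f': "\<And>x. (f has_real_derivative deriv f x) (at x)" and cont_f': "continuous_on UNIV (deriv f)"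
    and ac: "\<And>b c. abs_continuous_interval (deriv f) b c"
    and M: "\<And>x. \<bar>deriv f x\<bar> \<le> M"
    and ae: "AE x in lborel. deriv f differentiable (at x) \<and> Gamma_op \<mu> \<sigma> f x + h x \<ge> \<gamma>"
    and up: "\<And>x y. y < x \<Longrightarrow> f y - f x \<le> K + k * (x - y)"
    and down: "\<And>x y. x < y \<Longrightarrow> f y - f x \<le> L + l * (y - x)"
    and cont_h: "continuous_on UNIV h" and R: "\<And>x. \<bar>x\<bar> \<ge> R \<Longrightarrow> \<gamma> \<le> h x"
    and "\<epsilon> > 0"
  shows "\<exists>F u G B. bounded_subsolution \<mu> \<sigma> K L k l F u G B \<and> (\<forall>x. \<gamma> - \<epsilon> + G x \<le> h x)"
proof -
  have "M \<ge> 0" using M[of 0] by linarith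
  \<comment> \<open>The first bound gives \<open>h \<ge> \<gamma>\<close> off \<open>[-n, n]\<close>; the second makes the error \<open>\<sigma>\<^sup>2 * M / (2 * n)\<close>
    at most \<open>\<epsilon>\<close>.\<close>
  define n where "n = max (max 1 R) (\<sigma>\<^sup>2 * M / (2 * \<epsilon>))"
  have n: "n > 0" "R \<le> n" "\<sigma>\<^sup>2 * M / (2 * \<epsilon>) \<le> n" by (auto simp: n_def)
  have n\<epsilon>: "M / n \<le> 2 / \<sigma>\<^sup>2 * \<epsilon>"
    using n(1,3) \<open>\<epsilon> > 0\<close> pos(1) by (simp add: field_simps)
  define u where "u x = cutoff n x * deriv f x" for x
  define p where "p x = cutoff n x * (h x - \<gamma>)" for x
  define G where "G x = p x + \<epsilon>" for x
  have cont: "continuous_on UNIV u" "continuous_on UNIV p"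
    unfolding u_def p_def using cont_f' cont_h cutoff(7)[OF n(1)] by (auto intro!: continuous_intros)
  have supp: "u x = 0" "p x = 0" if "\<bar>x\<bar> \<ge> 2 * n" for x
    using cutoff(4)[OF n(1) that] by (auto simp: u_def p_def)
  have "2 * n > 0" using n by simp
  have "\<exists>F. \<forall>x. - \<infinity> < ereal x \<longrightarrow> ereal x < \<infinity> \<longrightarrow> (F has_vector_derivative u x) (at x)"
    using cont(1) by (intro einterval_antiderivative) (auto simp: continuous_on_eq_continuous_at)
  then obtain F where F': "\<And>x. (F has_real_derivative u x) (at x)"
    by (auto simp: has_real_derivative_iff_has_vector_derivative)
  obtain B1 where B1: "\<And>x. \<bar>F x\<bar> \<le> B1"
    using bounded_of_compactly_supported_derivative[OF F' supp(1) \<open>2 * n > 0\<close>] by blast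
  have mod_u: "\<exists>C\<ge>0. \<forall>x y. \<bar>u x - u y\<bar> \<le> \<eta> + C * \<bar>x - y\<bar>" if "\<eta> > 0" for \<eta>
    by (rule compact_support_modulus[OF cont(1) \<open>2 * n > 0\<close> supp(1) that])
  have mod_p: "\<exists>C\<ge>0. \<forall>x y. \<bar>p x - p y\<bar> \<le> \<eta> + C * \<bar>x - y\<bar>" if "\<eta> > 0" for \<eta>
    by (rule compact_support_modulus[OF cont(2) \<open>2 * n > 0\<close> supp(2) that])
  have "bounded (p ` {-2 * n..2 * n})"
    using compact_continuous_image[OF continuous_on_subset[OF cont(2)]] compact_imp_bounded by blast
  then obtain B2 where B0: "\<forall>y\<in>p ` {-2 * n..2 * n}. norm y \<le> B2" unfolding bounded_iff by blast
  have B2': "\<bar>p x\<bar> \<le> B2" if "\<bar>x\<bar> \<le> 2 * n" for x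
  proof -
    have "x \<in> {-2 * n..2 * n}" using that by auto
    then show ?thesis using B0 by (metis imageI real_norm_def)
  qed
  have B2: "\<bar>p x\<bar> \<le> max B2 0" for x
    using supp(2)[of x] B2'[of x] by (cases "\<bar>x\<bar> \<le> 2 * n") auto
  define B where "B = max B1 (max M (max B2 0 + \<epsilon>))"
  have "bounded_subsolution \<mu> \<sigma> K L k l F u G B"
  proof
    show "\<sigma> > 0" "K \<ge> 0" "L \<ge> 0" by fact+
    show "(F has_real_derivative u x) (at x)" for x by (rule F')
    show "continuous_on UNIV u" "continuous_on UNIV G"
      unfolding G_def using cont by (auto intro!: continuous_intros)
    show "\<bar>F x\<bar> \<le> B" for x using B1[of x] by (simp add: B_def)
    show "\<bar>u x\<bar> \<le> B" for x
    proof -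
      have "\<bar>u x\<bar> \<le> 1 * M"
        unfolding u_def abs_mult using cutoff(1,2)[OF n(1)] M by (intro mult_mono) auto
      then show ?thesis by (simp add: B_def)
    qed
    show "\<bar>G x\<bar> \<le> B" for x using B2[of x] \<open>\<epsilon> > 0\<close> by (auto simp: B_def G_def)
    show "\<exists>C\<ge>0. \<forall>x y. \<bar>u x - u y\<bar> \<le> \<eta> + C * \<bar>x - y\<bar>"
      "\<exists>C\<ge>0. \<forall>x y. \<bar>G x - G y\<bar> \<le> \<eta> + C * \<bar>x - y\<bar>" if "\<eta> > 0" for \<eta>
      using mod_u[OF that] mod_p[OF that] by (simp_all add: G_def)
    show "F x - F y \<le> K + k * (y - x)" if "x < y" for x y
      using pos up that cutoff(1,2,5,6)[OF n(1)]
      by (intro unimodal_cutoff_jump_bound[of f "deriv f" F "cutoff n"] f' F'[unfolded u_def]) auto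
    show "F y - F x \<le> L + l * (y - x)" if "x < y" for x y
    proof -
      have "- F x - - F y \<le> L + l * (y - x)"
      proof (rule unimodal_cutoff_jump_bound[of "\<lambda>x. - f x" "\<lambda>x. - deriv f x" "\<lambda>x. - F x" "cutoff n"])
        show "((\<lambda>x. - F x) has_real_derivative cutoff n x * - deriv f x) (at x)" for x
          using DERIV_minus[OF F'[of x]] by (simp add: u_def)
        show "((\<lambda>x. - f x) has_real_derivative - deriv f x) (at x)" for x
          by (rule DERIV_minus[OF f'])
      qed (use pos down that cutoff(1,2,5,6)[OF n(1)] in auto)
      then show ?thesis by simp
    qed
    fix x y m assume "x \<le> y" and m: "\<And>s. x \<le> s \<Longrightarrow> s \<le> y \<Longrightarrow> \<mu> * u s + G s \<le> m"
    have "- (2 / \<sigma>\<^sup>2 * m) * (y - x) \<le> cutoff n y * deriv f y - cutoff n x * deriv f x"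
    proof (rule abs_continuous_truncation_slope[where \<beta> = "1 / n" and M = M
          and m = "\<lambda>s. 2 / \<sigma>\<^sup>2 * (\<mu> * deriv f s + (h s - \<gamma>))"])
      show "AE s in lborel. deriv f differentiable (at s) \<and>
          - (2 / \<sigma>\<^sup>2 * (\<mu> * deriv f s + (h s - \<gamma>))) \<le> deriv (deriv f) s"
        using ae
      proof eventually_elim
        case (elim s)
        have "\<gamma> \<le> 1 / 2 * \<sigma>\<^sup>2 * deriv (deriv f) s + \<mu> * deriv f s + h s"
          using elim by (simp add: Gamma_op_def)
        then have "2 / \<sigma>\<^sup>2 * (\<gamma> - \<mu> * deriv f s - h s) \<le> 2 / \<sigma>\<^sup>2 * (1 / 2 * \<sigma>\<^sup>2 * deriv (deriv f) s)"
          by (intro mult_left_mono) auto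
        then show ?case using elim pos(1) by (simp add: algebra_simps)
      qed
      fix s assume s: "x \<le> s" "s \<le> y"
      have "cutoff n s * (2 / \<sigma>\<^sup>2 * (\<mu> * deriv f s + (h s - \<gamma>))) + 1 / n * M
          \<le> 2 / \<sigma>\<^sup>2 * (cutoff n s * (\<mu> * deriv f s + (h s - \<gamma>))) + 2 / \<sigma>\<^sup>2 * \<epsilon>"
        using n\<epsilon> by (simp add: mult.left_commute)
      also have "\<dots> = 2 / \<sigma>\<^sup>2 * (\<mu> * u s + G s)"
        by (simp add: u_def G_def p_def algebra_simps)
      also have "\<dots> \<le> 2 / \<sigma>\<^sup>2 * m" using m[OF s] by (intro mult_left_mono) auto
      finally show "cutoff n s * (2 / \<sigma>\<^sup>2 * (\<mu> * deriv f s + (h s - \<gamma>))) + 1 / n * M \<le> 2 / \<sigma>\<^sup>2 * m" .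
    qed (use ac M cutoff(1,2,8)[OF n(1)] \<open>x \<le> y\<close> in auto)
    then show "- (2 / \<sigma>\<^sup>2) * m * (y - x) \<le> u y - u x" by (simp add: u_def)
  qed
  moreover have "\<gamma> - \<epsilon> + G x \<le> h x" for x
  proof (cases "\<bar>x\<bar> \<le> n")
    case True
    then show ?thesis by (simp add: G_def p_def cutoff(3)[OF n(1)])
  next
    case False
    then have "0 \<le> h x - \<gamma>" using R[of x] n(2) by simp
    then have "cutoff n x * (h x - \<gamma>) \<le> 1 * (h x - \<gamma>)"
      using cutoff(2)[OF n(1)] by (intro mult_right_mono)
    then show ?thesis by (simp add: G_def p_def)
  qed
  ultimately show ?thesis by blast
qed

text \<open>
  By convexity \<open>h\<close> grows at least linearly away from its zero \<open>a\<close>.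
\<close>

lemma holding_cost_coercive:
  assumes "holding_cost \<mu> \<sigma> h"
  shows "\<exists>R. \<forall>x. \<bar>x\<bar> \<ge> R \<longrightarrow> \<gamma> \<le> h x"
proof -
  obtain a where conv: "convex_on UNIV h" and diff: "h C1_differentiable_on (- {a})" and "h a = 0"
    and der: "\<And>x. x < a \<Longrightarrow> deriv h x < 0" "\<And>x. x > a \<Longrightarrow> deriv h x > 0" and cont: "continuous_on UNIV h"
    using assms unfolding holding_cost_def by blast
  have h': "(h has_real_derivative deriv h x) (at x)" if "x \<noteq> a" for x
    using diff that by (auto simp: C1_differentiable_on_eq DERIV_deriv_iff_real_differentiable)
  have C: "continuous_on S h" for S using cont continuous_on_subset by blast
  have right: "\<exists>y. (h has_real_derivative y) (at x) \<and> y > 0" if "x > a" for x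
    using h'[of x] der(2)[of x] that by blast
  have left: "\<exists>y. (h has_real_derivative y) (at x) \<and> y < 0" if "x < a" for x
    using h'[of x] der(1)[of x] that by blast
  have "h a < h (a + 1)"
    by (rule DERIV_pos_imp_increasing_open[OF _ right C]) auto
  moreover have "h (a - 1) > h a"
    by (rule DERIV_neg_imp_decreasing_open[OF _ left C]) auto
  ultimately have p: "h (a + 1) > 0" "h (a - 1) > 0" using \<open>h a = 0\<close> by auto
  define c where "c = min (h (a + 1)) (h (a - 1))"
  have "c > 0" using p by (simp add: c_def)
  have growth: "c * \<bar>x - a\<bar> \<le> h x" if "\<bar>x - a\<bar> \<ge> 1" for x
  proof -
    define s where "s = \<bar>x - a\<bar>"
    have "s \<ge> 1" using that by (simp add: s_def)
    have "c \<le> h (a + sgn (x - a))" using that by (auto simp: c_def sgn_if)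
    also have "a + sgn (x - a) = (1 - 1 / s) * a + (1 / s) * x"
      using \<open>s \<ge> 1\<close> by (auto simp: s_def sgn_if abs_if field_simps split: if_splits)
    also have "h \<dots> \<le> (1 - 1 / s) * h a + (1 / s) * h x"
      using convex_onD[OF conv, of "1 / s" a x] \<open>s \<ge> 1\<close> by simp
    finally show ?thesis using \<open>h a = 0\<close> \<open>s \<ge> 1\<close> by (simp add: s_def field_simps)
  qed
  have "\<gamma> \<le> h x" if "\<bar>x\<bar> \<ge> \<bar>a\<bar> + 1 + \<bar>\<gamma>\<bar> / c" for x
  proof -
    have "0 \<le> \<bar>\<gamma>\<bar> / c" using \<open>c > 0\<close> by simp
    then have x: "\<bar>x - a\<bar> \<ge> 1" "\<bar>x - a\<bar> \<ge> \<bar>\<gamma>\<bar> / c" using that by linarith+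
    have "\<gamma> \<le> c * (\<bar>\<gamma>\<bar> / c)" using \<open>c > 0\<close> by simp
    also have "\<dots> \<le> c * \<bar>x - a\<bar>" using x \<open>c > 0\<close> by (intro mult_left_mono) auto
    also have "\<dots> \<le> h x" by (rule growth[OF x(1)])
    finally show ?thesis .
  qed
  then show ?thesis by blast
qed

section \<open>Increasing points of a monotone path\<close>

text \<open>
  With \<open>c\<close> strictly between \<open>y a\<close> and \<open>y b\<close>, the last time \<open>s\<close> at which \<open>y \<le> c\<close> is an increasing point:
  \<open>y\<close> exceeds \<open>c\<close> after \<open>s\<close> but is at most \<open>c\<close> before. Right continuity at \<open>a\<close> excludes \<open>s = a\<close>,
  so the points found for consecutive intervals are distinct.
\<close>

lemma increasing_point_between:
  assumes mono: "mono_on {0..} y" and rc: "\<And>t. 0 \<le> t \<Longrightarrow> continuous (at_right t) y"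
    and ll: "\<And>t. 0 < t \<Longrightarrow> \<exists>c. (y \<longlongrightarrow> c) (at_left t)"
    and "0 \<le> a" and less: "y a < y b" and "a \<le> b"
  shows "\<exists>s. a < s \<and> s \<le> b \<and> increasing_point y s"
proof -
  define c where "c = (y a + y b) / 2"
  have c: "y a < c" "c < y b" using less by (auto simp: c_def)
  define S where "S = {t. a \<le> t \<and> t \<le> b \<and> y t \<le> c}"
  define s where "s = Sup S"
  have S: "a \<in> S" "bdd_above S" using c \<open>a \<le> b\<close> by (auto simp: S_def intro: bdd_aboveI[of _ b])
  have "s \<le> b" unfolding s_def using S by (intro cSup_least) (auto simp: S_def)
  have "(y \<longlongrightarrow> y a) (at_right a)" using rc[OF \<open>0 \<le> a\<close>] by (simp add: continuous_within)
  then have "\<forall>\<^sub>F t in at_right a. y t < c" using c(1) by (rule order_tendstoD)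
  then obtain d where d: "d > a" "\<And>t. a < t \<Longrightarrow> t < d \<Longrightarrow> y t < c"
    unfolding eventually_at_right_field by blast
  have "a < b" using less \<open>a \<le> b\<close> by (cases "a = b") auto
  obtain t where t: "a < t" "t < min d b" using dense[of a "min d b"] \<open>a < d\<close> \<open>a < b\<close> by auto
  then have "t \<in> S" using d(2)[of t] by (auto simp: S_def)
  then have "a < s" using cSup_upper[OF _ S(2), of t] t(1) by (simp add: s_def)
  have above: "c < y s'" if "s < s'" for s'
  proof (cases "s' \<le> b")
    case True
    then have "s' \<notin> S" using cSup_upper[OF _ S(2), of s'] that by (auto simp: s_def)
    then show ?thesis using True that \<open>a < s\<close> by (auto simp: S_def)
  next
    case False
    then have "y b \<le> y s'" using mono \<open>0 \<le> a\<close> \<open>a \<le> b\<close> by (intro mono_onD[OF mono]) auto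
    then show ?thesis using c by simp
  qed
  obtain m where m: "(y \<longlongrightarrow> m) (at_left s)" using ll[of s] \<open>a < s\<close> \<open>0 \<le> a\<close> by auto
  have "\<forall>\<^sub>F t in at_left s. y t \<le> c"
    unfolding eventually_at_left_field
  proof (intro exI[of _ a] conjI \<open>a < s\<close> allI impI)
    fix t assume t: "a < t" "t < s"
    then obtain t' where t': "t' \<in> S" "t < t'" unfolding s_def using less_cSupE[of t S] S(1) by blast
    then have "y t \<le> y t'" using t \<open>0 \<le> a\<close> by (intro mono_onD[OF mono]) auto
    then show "y t \<le> c" using t'(1) by (simp add: S_def)
  qed
  then have "m \<le> c" using m by (intro tendsto_upperbound[OF m]) auto
  moreover have "Lim (at_left s) y = m" using m by (intro tendsto_Lim) auto
  ultimately have "left_value y s \<le> c" using \<open>a < s\<close> \<open>0 \<le> a\<close> by (simp add: left_value_def)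
  then have "increasing_point y s"
    using above \<open>a < s\<close> \<open>0 \<le> a\<close> by (force simp: increasing_point_def)
  then show ?thesis using \<open>a < s\<close> \<open>s \<le> b\<close> by blast
qed

text \<open>
  The number of grid intervals \<open>(i * \<delta>, (i + 1) * \<delta>]\<close> with \<open>i < n\<close> in which \<open>y\<close> increases, where a jump at time \<open>0\<close>
  is counted too. Unlike \<^const>\<open>num_increasing\<close>, it is obviously a measurable function of the path.
\<close>

definition active_intervals :: "(real \<Rightarrow> real) \<Rightarrow> real \<Rightarrow> nat \<Rightarrow> real" where
  "active_intervals y \<delta> n =
     (if y 0 > 0 then 1 else 0) + (\<Sum>i<n. if y (real i * \<delta>) < y (real (Suc i) * \<delta>) then 1 else 0)"

lemma active_intervals_le_num_increasing:
  assumes mono: "mono_on {0..} y" and rc: "\<And>t. 0 \<le> t \<Longrightarrow> continuous (at_right t) y"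
    and ll: "\<And>t. 0 < t \<Longrightarrow> \<exists>c. (y \<longlongrightarrow> c) (at_left t)" and "\<delta> \<ge> 0"
  shows "ennreal (active_intervals y \<delta> n) \<le> num_increasing y (real n * \<delta>)"
proof (induction n)
  case 0
  have "increasing_point y 0" if "y 0 > 0"
    unfolding increasing_point_def left_value_def
  proof (intro conjI allI impI)
    fix s :: real assume "s > 0"
    then have "y 0 \<le> y s" by (intro mono_onD[OF mono]) auto
    then show "0 < y s - (if 0 = (0::real) then 0 else Lim (at_left 0) y)" using that by simp
  qed simp
  then have "{0} \<subseteq> {s \<in> {0..0}. increasing_point y s}" if "y 0 > 0" using that by auto
  then have "emeasure (count_space UNIV) {0::real} \<le> num_increasing y 0" if "y 0 > 0"
    unfolding num_increasing_def using that by (intro emeasure_mono) auto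
  then show ?case by (auto simp: active_intervals_def)
next
  case (Suc n)
  let ?a = "real n * \<delta>" and ?b = "real (Suc n) * \<delta>"
  let ?N = "\<lambda>t. {s \<in> {0..t}. increasing_point y s}"
  have ab: "0 \<le> ?a" "?a \<le> ?b" using \<open>\<delta> \<ge> 0\<close> by (auto simp: mult_right_mono)
  have nonneg: "0 \<le> active_intervals y \<delta> n" by (auto simp: active_intervals_def intro!: add_nonneg_nonneg sum_nonneg)
  show ?case
  proof (cases "y ?a < y ?b")
    case True
    obtain s where s: "?a < s" "s \<le> ?b" "increasing_point y s"
      using increasing_point_between[OF mono rc ll ab(1) True ab(2)] by blast
    have "active_intervals y \<delta> (Suc n) = active_intervals y \<delta> n + 1"
      using True by (simp add: active_intervals_def)
    then have "ennreal (active_intervals y \<delta> (Suc n)) = ennreal (active_intervals y \<delta> n) + 1"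
      using ennreal_plus[OF nonneg, of 1] by simp
    also have "\<dots> \<le> num_increasing y ?a + emeasure (count_space UNIV) {s}"
      using Suc by (intro add_mono) auto
    also have "\<dots> = emeasure (count_space UNIV) (?N ?a \<union> {s})"
      unfolding num_increasing_def using s by (intro plus_emeasure) auto
    also have "\<dots> \<le> num_increasing y ?b"
      unfolding num_increasing_def using s ab by (intro emeasure_mono) auto
    finally show ?thesis .
  next
    case False
    then have "ennreal (active_intervals y \<delta> (Suc n)) \<le> num_increasing y ?a"
      using Suc by (simp add: active_intervals_def)
    also have "\<dots> \<le> num_increasing y ?b"
      unfolding num_increasing_def using ab by (intro emeasure_mono) auto
    finally show ?thesis .
  qed
qed

section \<open>Processes and increments of the Brownian motion\<close>

lemma (in prob_space) indep_set_mono: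
  assumes "indep_set A B" "A' \<subseteq> A" "B' \<subseteq> B"
  shows "indep_set A' B'"
  using assms unfolding indep_set_def
  by (elim indep_sets_mono_sets) (auto split: bool.split)

lemma (in prob_space) indep_var_of_indep_set:
  fixes D X :: "'a \<Rightarrow> real" and \<phi> :: "real \<Rightarrow> real"
  assumes sub: "subalgebra M N" and indep: "indep_set (sets N) {D -` A \<inter> space M | A. A \<in> sets borel}"
    and X: "X \<in> borel_measurable N" and D: "D \<in> borel_measurable M" and [measurable]: "\<phi> \<in> borel_measurable borel"
  shows "indep_var borel X borel (\<lambda>\<omega>. \<phi> (D \<omega>))"
  unfolding indep_var_eq
proof (intro conjI)
  have sp: "space N = space M" using sub by (simp add: subalgebra_def)
  show "random_variable borel X" using measurable_from_subalg[OF sub X] .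
  show "random_variable borel (\<lambda>\<omega>. \<phi> (D \<omega>))" using D by measurable
  show "indep_set (sigma_sets (space M) {X -` A \<inter> space M | A. A \<in> sets borel})
      (sigma_sets (space M) {(\<lambda>\<omega>. \<phi> (D \<omega>)) -` A \<inter> space M | A. A \<in> sets borel})"
  proof (rule indep_set_mono[OF indep])
    show "sigma_sets (space M) {X -` A \<inter> space M | A. A \<in> sets borel} \<subseteq> sets N"
      using measurable_sets[OF X] unfolding sp[symmetric] by (intro sets.sigma_sets_subset) auto
    let ?V = "vimage_algebra (space M) D borel"
    have V: "sets ?V = {D -` A \<inter> space M | A. A \<in> sets borel}"
      by (rule sets_vimage_algebra2) auto
    have "{(\<lambda>\<omega>. \<phi> (D \<omega>)) -` A \<inter> space M | A. A \<in> sets borel} \<subseteq> sets ?V"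
    proof safe
      fix A :: "real set" assume "A \<in> sets borel"
      then have "\<phi> -` A \<in> sets borel" using measurable_sets[of \<phi> borel borel A] by simp
      then show "(\<lambda>\<omega>. \<phi> (D \<omega>)) -` A \<inter> space M \<in> sets ?V"
        unfolding V by (intro CollectI exI[of _ "\<phi> -` A"]) auto
    qed
    from sets.sigma_sets_subset[OF this]
    show "sigma_sets (space M) {(\<lambda>\<omega>. \<phi> (D \<omega>)) -` A \<inter> space M | A. A \<in> sets borel}
        \<subseteq> {D -` A \<inter> space M | A. A \<in> sets borel}"
      by (simp add: V)
  qed
qed

locale controlled_inventory =
  fixes P :: "'a measure" and \<F> :: "real \<Rightarrow> 'a measure" and W Y1 Y2 :: "real \<Rightarrow> 'a \<Rightarrow> real"
    and \<mu> \<sigma> x :: real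
  assumes filtered: "filtered_prob_space P \<F>" and BM: "standard_BM P \<F> W"
    and control: "control_process P \<F> Y1" "control_process P \<F> Y2"
    and finite_control: "\<And>t. t \<ge> 0 \<Longrightarrow> (\<integral>\<^sup>+\<omega>. ennreal (Y1 t \<omega>) \<partial>P) < \<infinity>"
      "\<And>t. t \<ge> 0 \<Longrightarrow> (\<integral>\<^sup>+\<omega>. ennreal (Y2 t \<omega>) \<partial>P) < \<infinity>"

sublocale controlled_inventory \<subseteq> prob_space P
  using filtered by (simp add: filtered_prob_space_def)

context controlled_inventory
begin

abbreviation Z :: "real \<Rightarrow> 'a \<Rightarrow> real" where
  "Z \<equiv> inventory \<mu> \<sigma> W x (Y1, Y2)"

lemma Z_eq: "Z t \<omega> = x + \<mu> * t + \<sigma> * W t \<omega> + Y1 t \<omega> - Y2 t \<omega>"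
  by (simp add: inventory_def)

lemma filtration_subalgebra: "t \<ge> 0 \<Longrightarrow> subalgebra P (\<F> t)"
  using filtered by (simp add: filtered_prob_space_def)

lemma adapted:
  assumes "t \<ge> 0"
  shows "W t \<in> borel_measurable (\<F> t)" "Y1 t \<in> borel_measurable (\<F> t)"
    "Y2 t \<in> borel_measurable (\<F> t)" "Z t \<in> borel_measurable (\<F> t)"
proof -
  show *: "W t \<in> borel_measurable (\<F> t)" "Y1 t \<in> borel_measurable (\<F> t)" "Y2 t \<in> borel_measurable (\<F> t)"
    using assms BM control by (auto simp: standard_BM_def control_process_def adapted_process_def)
  show "Z t \<in> borel_measurable (\<F> t)"
    unfolding Z_eq[abs_def] using * by measurable
qed

lemma measurable_process [measurable (raw)]:
  assumes "t \<ge> 0"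
  shows "W t \<in> borel_measurable P" "Y1 t \<in> borel_measurable P" "Y2 t \<in> borel_measurable P" "Z t \<in> borel_measurable P"
  using adapted[OF assms] measurable_from_subalg[OF filtration_subalgebra[OF assms]] by blast+

lemma control_path:
  assumes "\<omega> \<in> space P"
  shows "mono_on {0..} (\<lambda>s. Y1 s \<omega>)" "mono_on {0..} (\<lambda>s. Y2 s \<omega>)" "0 \<le> Y1 0 \<omega>" "0 \<le> Y2 0 \<omega>"
    "t \<ge> 0 \<Longrightarrow> continuous (at_right t) (\<lambda>s. Y1 s \<omega>)" "t \<ge> 0 \<Longrightarrow> continuous (at_right t) (\<lambda>s. Y2 s \<omega>)"
    "t > 0 \<Longrightarrow> \<exists>c. ((\<lambda>s. Y1 s \<omega>) \<longlongrightarrow> c) (at_left t)" "t > 0 \<Longrightarrow> \<exists>c. ((\<lambda>s. Y2 s \<omega>) \<longlongrightarrow> c) (at_left t)"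
  using control assms unfolding control_process_def by blast+

lemma control_mono:
  assumes "\<omega> \<in> space P" "0 \<le> s" "s \<le> t"
  shows "Y1 s \<omega> \<le> Y1 t \<omega>" "Y2 s \<omega> \<le> Y2 t \<omega>"
  using control_path(1,2)[OF assms(1)] assms(2,3) by (auto simp: mono_on_def)

lemma control_nonneg:
  assumes "\<omega> \<in> space P" "0 \<le> t"
  shows "0 \<le> Y1 t \<omega>" "0 \<le> Y2 t \<omega>"
  using control_mono[OF assms(1) order_refl assms(2)] control_path(3,4)[OF assms(1)] by auto

lemma integrable_control:
  assumes "t \<ge> 0"
  shows "integrable P (Y1 t)" "integrable P (Y2 t)"
  using assms finite_control[OF assms] control_nonneg
  by (auto intro!: integrableI_nonneg)

lemma expectation_control_mono:
  assumes "0 \<le> s" "s \<le> t"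
  shows "expectation (Y1 s) \<le> expectation (Y1 t)" "expectation (Y2 s) \<le> expectation (Y2 t)"
  using assms control_mono integrable_control by (auto intro!: integral_mono)

lemma increment_moments:
  assumes "0 \<le> s" "s < t"
  defines "D \<equiv> \<lambda>\<omega>. W t \<omega> - W s \<omega>"
  shows "integrable P D" "expectation D = 0"
    "integrable P (\<lambda>\<omega>. (D \<omega>)\<^sup>2)" "expectation (\<lambda>\<omega>. (D \<omega>)\<^sup>2) = t - s"
    "integrable P (\<lambda>\<omega>. D \<omega> ^ 4)" "expectation (\<lambda>\<omega>. D \<omega> ^ 4) = 3 * (t - s)\<^sup>2"
proof -
  define v where "v = sqrt (t - s)"
  have v: "v > 0" "v\<^sup>2 = t - s" using assms by (auto simp: v_def)
  have D: "distributed P lborel D (normal_density 0 v)"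
    using BM assms unfolding standard_BM_def v_def by auto
  have *: "integrable P (\<lambda>\<omega>. \<phi> (D \<omega>)) \<and> expectation (\<lambda>\<omega>. \<phi> (D \<omega>)) = c"
    if "has_bochner_integral lborel (\<lambda>y. normal_density 0 v y * \<phi> y) c" "\<phi> \<in> borel_measurable borel" for \<phi> c
    using that distributed_integrable[OF D, of \<phi>] distributed_integral[OF D, of \<phi>]
    by (auto simp: has_bochner_integral_iff)
  show "integrable P D" "expectation D = 0"
    using *[of "\<lambda>y. y"] normal_moment_odd[OF v(1), of 0 0] by auto
  show "integrable P (\<lambda>\<omega>. (D \<omega>)\<^sup>2)" "expectation (\<lambda>\<omega>. (D \<omega>)\<^sup>2) = t - s"
    using *[of "\<lambda>y. y\<^sup>2"] normal_moment_even[OF v(1), of 0 1] v by (auto simp: fact_numeral)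
  have "fact 4 / ((2 / v\<^sup>2)\<^sup>2 * fact 2) = 3 * (t - s)\<^sup>2"
    unfolding v(2)[symmetric] using v(1) by (simp add: fact_numeral field_simps power2_eq_square)
  then show "integrable P (\<lambda>\<omega>. D \<omega> ^ 4)" "expectation (\<lambda>\<omega>. D \<omega> ^ 4) = 3 * (t - s)\<^sup>2"
    using *[of "\<lambda>y. y ^ 4"] normal_moment_even[OF v(1), of 0 2] by auto
qed

text \<open>
  The only way in which independence of the increments enters: bounded functions of the past and
  functions of the increment have factorising expectations.
\<close>

lemma expectation_mult_increment:
  fixes X :: "'a \<Rightarrow> real" and \<phi> :: "real \<Rightarrow> real"
  assumes "0 \<le> s" "s < t" and X: "X \<in> borel_measurable (\<F> s)" "\<And>\<omega>. \<bar>X \<omega>\<bar> \<le> B"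
    and \<phi>: "\<phi> \<in> borel_measurable borel" "integrable P (\<lambda>\<omega>. \<phi> (W t \<omega> - W s \<omega>))"
  shows "integrable P (\<lambda>\<omega>. X \<omega> * \<phi> (W t \<omega> - W s \<omega>))"
    "expectation (\<lambda>\<omega>. X \<omega> * \<phi> (W t \<omega> - W s \<omega>)) = expectation X * expectation (\<lambda>\<omega>. \<phi> (W t \<omega> - W s \<omega>))"
proof -
  have t: "0 \<le> t" using assms by simp
  have i: "indep_var borel X borel (\<lambda>\<omega>. \<phi> (W t \<omega> - W s \<omega>))"
  proof (rule indep_var_of_indep_set[OF filtration_subalgebra[OF \<open>0 \<le> s\<close>] _ X(1) _ \<phi>(1)])
    show "indep_set (sets (\<F> s)) {(\<lambda>\<omega>. W t \<omega> - W s \<omega>) -` A \<inter> space P | A. A \<in> sets borel}"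
      using BM assms(1,2) unfolding standard_BM_def by blast
    show "(\<lambda>\<omega>. W t \<omega> - W s \<omega>) \<in> borel_measurable P" using measurable_process \<open>0 \<le> s\<close> t by simp
  qed
  have "integrable P X"
    using X measurable_from_subalg[OF filtration_subalgebra[OF \<open>0 \<le> s\<close>] X(1)] by (intro integrable_const_bound[of _ B]) auto
  then show "integrable P (\<lambda>\<omega>. X \<omega> * \<phi> (W t \<omega> - W s \<omega>))"
    "expectation (\<lambda>\<omega>. X \<omega> * \<phi> (W t \<omega> - W s \<omega>)) = expectation X * expectation (\<lambda>\<omega>. \<phi> (W t \<omega> - W s \<omega>))"
    using indep_var_integrable[OF i] indep_var_lebesgue_integral[OF i] \<phi>(2) by auto
qed

lemma Z_right_continuous:
  assumes "\<omega> \<in> space P" "t \<ge> 0"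
  shows "((\<lambda>s. Z s \<omega>) \<longlongrightarrow> Z t \<omega>) (at_right t)"
proof -
  have "continuous_on {0..} (\<lambda>s. W s \<omega>)" using BM assms(1) unfolding standard_BM_def by blast
  then have "((\<lambda>s. W s \<omega>) \<longlongrightarrow> W t \<omega>) (at t within {0..})"
    using assms(2) by (simp add: continuous_on_def)
  then have "((\<lambda>s. W s \<omega>) \<longlongrightarrow> W t \<omega>) (at_right t)"
    by (rule tendsto_within_subset) (use assms(2) in auto)
  moreover have "((\<lambda>s. Y1 s \<omega>) \<longlongrightarrow> Y1 t \<omega>) (at_right t)" "((\<lambda>s. Y2 s \<omega>) \<longlongrightarrow> Y2 t \<omega>) (at_right t)"
    using control_path(5,6)[OF assms] by (simp_all add: continuous_within)
  ultimately show ?thesis unfolding Z_eq by (intro tendsto_intros)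
qed

text \<open>
  Joint measurability in \<open>(\<omega>, r)\<close> comes from right continuity: the process is the limit of its values
  at the next grid time strictly after \<open>r\<close>. Truncation by \<open>max 0\<close> avoids negative times, about which
  nothing is known.
\<close>

lemma measurable_Z_pair:
  "(\<lambda>(\<omega>, r). Z (max 0 r) \<omega>) \<in> borel_measurable (P \<Otimes>\<^sub>M lborel)"
proof -
  define c where "c n r = (real_of_int \<lfloor>r * real (Suc n)\<rfloor> + 1) / real (Suc n)" for n :: nat and r :: real
  have c: "r < c n r" "c n r \<le> r + 1 / real (Suc n)" for n r
  proof -
    have "r * real (Suc n) < real_of_int \<lfloor>r * real (Suc n)\<rfloor> + 1" by linarith
    then show "r < c n r" unfolding c_def by (simp add: pos_less_divide_eq del: of_nat_Suc)
    have "c n r \<le> (r * real (Suc n) + 1) / real (Suc n)"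
      unfolding c_def by (intro divide_right_mono add_right_mono) auto
    also have "\<dots> = r + 1 / real (Suc n)" by (simp add: add_divide_distrib del: of_nat_Suc)
    finally show "c n r \<le> r + 1 / real (Suc n)" .
  qed
  have lim: "(\<lambda>n. c n r) \<longlonglongrightarrow> r" for r
  proof (rule real_tendsto_sandwich[where f = "\<lambda>n. r" and h = "\<lambda>n. r + 1 / real (Suc n)"])
    show "(\<lambda>n. r + 1 / real (Suc n)) \<longlonglongrightarrow> r"
      using LIMSEQ_inverse_real_of_nat_add[of r] by (simp add: inverse_eq_divide)
  qed (intro always_eventually allI c less_imp_le[OF c(1)] tendsto_const)+
  show ?thesis
  proof (rule borel_measurable_LIMSEQ_real)
    fix \<omega>r :: "'a \<times> real" assume "\<omega>r \<in> space (P \<Otimes>\<^sub>M lborel)"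
    then obtain \<omega> and r :: real where \<omega>r: "\<omega>r = (\<omega>, r)" "\<omega> \<in> space P" by (auto simp: space_pair_measure)
    have "(\<lambda>n. Z (max 0 (c n r)) \<omega>) \<longlonglongrightarrow> Z (max 0 r) \<omega>"
    proof (cases "r \<ge> 0")
      case True
      have "filterlim (\<lambda>n. c n r) (at_right r) sequentially"
        using lim c(1) by (intro tendsto_imp_filterlim_at_right) auto
      from filterlim_compose[OF Z_right_continuous[OF \<omega>r(2) True] this]
      have "(\<lambda>n. Z (c n r) \<omega>) \<longlonglongrightarrow> Z r \<omega>" .
      moreover have "max 0 (c n r) = c n r" for n using c(1)[of r n] True by simp
      ultimately show ?thesis using True by simp
    next
      case False
      then have "\<forall>\<^sub>F n in sequentially. c n r < 0" using lim by (intro order_tendstoD) auto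
      then have "\<forall>\<^sub>F n in sequentially. Z (max 0 (c n r)) \<omega> = Z (max 0 r) \<omega>"
        using False by (auto elim!: eventually_mono)
      then show ?thesis by (rule tendsto_eventually)
    qed
    then show "(\<lambda>n. case \<omega>r of (\<omega>, r) \<Rightarrow> Z (max 0 (c n r)) \<omega>) \<longlonglongrightarrow> (case \<omega>r of (\<omega>, r) \<Rightarrow> Z (max 0 r) \<omega>)"
      by (simp add: \<omega>r)
  next
    fix n :: nat
    have *: "(\<lambda>\<omega>r. Z (max 0 ((real_of_int i + 1) / real (Suc n))) (fst \<omega>r)) \<in> borel_measurable (P \<Otimes>\<^sub>M lborel)" for i :: int
      by (rule measurable_compose[OF measurable_fst measurable_process(4)]) simp
    have "(\<lambda>\<omega>r. Z (max 0 ((real_of_int \<lfloor>snd \<omega>r * real (Suc n)\<rfloor> + 1) / real (Suc n))) (fst \<omega>r))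
        \<in> borel_measurable (P \<Otimes>\<^sub>M lborel)"
      by (rule measurable_compose_countable[OF *]) measurable
    then show "(\<lambda>(\<omega>, r). Z (max 0 (c n r)) \<omega>) \<in> borel_measurable (P \<Otimes>\<^sub>M lborel)"
      by (simp add: c_def case_prod_unfold)
  qed
qed

end

section \<open>The expected cost of one short time step\<close>

lemma power4_add_le:
  fixes a b :: real
  shows "(a + b) ^ 4 \<le> 8 * (a ^ 4 + b ^ 4)"
proof -
  have sq: "(c + d)\<^sup>2 \<le> 2 * (c\<^sup>2 + d\<^sup>2)" for c d :: real
    using sum_squares_bound[of c d] by (simp add: power2_sum)
  have "(a + b) ^ 4 = ((a + b)\<^sup>2)\<^sup>2" by simp
  also have "\<dots> \<le> (2 * (a\<^sup>2 + b\<^sup>2))\<^sup>2" using sq[of a b] by (intro power_mono) auto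
  also have "\<dots> = 4 * (a\<^sup>2 + b\<^sup>2)\<^sup>2" by (simp only: power_mult_distrib) simp
  also have "\<dots> \<le> 4 * (2 * ((a\<^sup>2)\<^sup>2 + (b\<^sup>2)\<^sup>2))" by (intro mult_left_mono sq) auto
  finally show ?thesis by simp
qed

lemma linear_le_quadratic:
  fixes C r \<eta> :: real
  assumes "\<eta> > 0"
  shows "C * \<bar>r\<bar> \<le> \<eta> + C\<^sup>2 / \<eta> * r\<^sup>2"
proof -
  have "2 * (C * \<bar>r\<bar>) * \<eta> \<le> (C * \<bar>r\<bar>)\<^sup>2 + \<eta>\<^sup>2"
    by (rule sum_squares_bound)
  moreover have "0 \<le> (C * \<bar>r\<bar>)\<^sup>2" "0 \<le> \<eta>\<^sup>2" by simp_all
  ultimately have "C * \<bar>r\<bar> * \<eta> \<le> \<eta>\<^sup>2 + (C * \<bar>r\<bar>)\<^sup>2" by linarith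
  then show ?thesis using assms by (simp add: field_simps power2_eq_square)
qed

locale verification =
  controlled_inventory P \<F> W Y1 Y2 \<mu> \<sigma> x + bounded_subsolution \<mu> \<sigma> K L k l F u G B
  for P :: "'a measure" and \<F> W Y1 Y2 \<mu> \<sigma> x K L k l F u G B
begin

lemma borel_functions [measurable]:
  "F \<in> borel_measurable borel" "u \<in> borel_measurable borel" "G \<in> borel_measurable borel"
proof -
  have "continuous_on UNIV F"
    using F' by (intro continuous_at_imp_continuous_on) (auto intro: DERIV_isCont)
  then show "F \<in> borel_measurable borel" "u \<in> borel_measurable borel" "G \<in> borel_measurable borel"
    using cont by (auto intro: borel_measurable_continuous_onI)
qed

lemma integrable_bounded_of_Z:
  assumes "t \<ge> 0"
  shows "integrable P (\<lambda>\<omega>. F (Z t \<omega>))" "integrable P (\<lambda>\<omega>. u (Z t \<omega>))" "integrable P (\<lambda>\<omega>. G (Z t \<omega>))"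
proof -
  have [measurable]: "Z t \<in> borel_measurable P" using measurable_process assms by blast
  show "integrable P (\<lambda>\<omega>. F (Z t \<omega>))" "integrable P (\<lambda>\<omega>. u (Z t \<omega>))" "integrable P (\<lambda>\<omega>. G (Z t \<omega>))"
    by (rule integrable_const_bound[of _ B]; use bounded in simp)+
qed

text \<open>
  A step without control. Expand \<open>F\<close> to second order around \<open>Z s\<close> with increment
  \<open>\<xi> = \<mu> * (t - s) + \<sigma> * (W t - W s)\<close>. Since \<open>\<xi>\<close> is independent of \<open>Z s\<close>, with mean \<open>\<mu> * (t - s)\<close> and
  second moment close to \<open>\<sigma>\<^sup>2 * (t - s)\<close>, the first order term contributes \<open>(t - s) * \<mu> * E u\<close> and the second
  order term at least \<open>- (t - s) * E (\<mu> * u + G)\<close>. The drift terms cancel and \<open>- (t - s) * E G\<close> is left.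
\<close>

lemma diffusion_step:
  assumes st: "0 \<le> s" "s < t" "t - s \<le> 1" and "\<eta> > 0" "C \<ge> 0"
    and q: "\<And>y z. \<bar>(\<mu> * u y + G y) - (\<mu> * u z + G z)\<bar> \<le> \<eta> + C * (y - z)\<^sup>2"
  shows "expectation (\<lambda>\<omega>. F (Z s \<omega>)) \<le>
      expectation (\<lambda>\<omega>. F (Z s \<omega> + (\<mu> * (t - s) + \<sigma> * (W t \<omega> - W s \<omega>))))
      + (t - s) * expectation (\<lambda>\<omega>. G (Z s \<omega>)) + (t - s) * \<eta>
      + (t - s)\<^sup>2 * (\<mu>\<^sup>2 / \<sigma>\<^sup>2 * ((\<bar>\<mu>\<bar> + 1) * B + \<eta>) + 4 * C / \<sigma>\<^sup>2 * (\<mu> ^ 4 + 3 * \<sigma> ^ 4))"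
proof -
  define \<delta> where "\<delta> = t - s"
  define D where "D = (\<lambda>\<omega>. W t \<omega> - W s \<omega>)"
  define q where "q y = \<mu> * u y + G y + \<eta>" for y
  have \<delta>: "0 < \<delta>" "\<delta> \<le> 1" using st by (auto simp: \<delta>_def)
  have [measurable]: "Z s \<in> borel_measurable P" "W s \<in> borel_measurable P" "W t \<in> borel_measurable P"
    using measurable_process st by auto
  have mq [measurable]: "q \<in> borel_measurable borel" unfolding q_def by measurable
  have Zs: "Z s \<in> borel_measurable (\<F> s)" using adapted st by blast
  have mom: "integrable P D" "expectation D = 0"
    "integrable P (\<lambda>\<omega>. (D \<omega>)\<^sup>2)" "expectation (\<lambda>\<omega>. (D \<omega>)\<^sup>2) = \<delta>"
    "integrable P (\<lambda>\<omega>. D \<omega> ^ 4)" "expectation (\<lambda>\<omega>. D \<omega> ^ 4) = 3 * \<delta>\<^sup>2"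
    unfolding D_def \<delta>_def by (rule increment_moments[OF st(1,2)])+
  have B: "B \<ge> 0" using bounded(1)[of 0] by linarith
  have qB: "\<bar>q y\<bar> \<le> (\<bar>\<mu>\<bar> + 1) * B + \<eta>" for y
  proof -
    have "\<bar>\<mu> * u y\<bar> \<le> \<bar>\<mu>\<bar> * B" unfolding abs_mult using bounded(2) by (intro mult_left_mono) auto
    then show ?thesis using bounded(3)[of y] \<open>\<eta> > 0\<close> unfolding q_def by (simp add: algebra_simps)
  qed
  have uD: "integrable P (\<lambda>\<omega>. u (Z s \<omega>) * D \<omega>)" "expectation (\<lambda>\<omega>. u (Z s \<omega>) * D \<omega>) = 0"
    using expectation_mult_increment[OF st(1,2), of "\<lambda>\<omega>. u (Z s \<omega>)" B "\<lambda>y. y"]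
      measurable_compose[OF Zs borel_functions(2)] bounded(2) mom(1,2) by (simp_all add: D_def)
  have qD: "integrable P (\<lambda>\<omega>. q (Z s \<omega>) * D \<omega>)" "expectation (\<lambda>\<omega>. q (Z s \<omega>) * D \<omega>) = 0"
    using expectation_mult_increment[OF st(1,2), of "\<lambda>\<omega>. q (Z s \<omega>)" "(\<bar>\<mu>\<bar> + 1) * B + \<eta>" "\<lambda>y. y"]
      measurable_compose[OF Zs mq] qB mom(1,2) by (simp_all add: D_def)
  have qD2: "integrable P (\<lambda>\<omega>. q (Z s \<omega>) * (D \<omega>)\<^sup>2)"
    "expectation (\<lambda>\<omega>. q (Z s \<omega>) * (D \<omega>)\<^sup>2) = expectation (\<lambda>\<omega>. q (Z s \<omega>)) * \<delta>"
    using expectation_mult_increment[OF st(1,2), of "\<lambda>\<omega>. q (Z s \<omega>)" "(\<bar>\<mu>\<bar> + 1) * B + \<eta>" "\<lambda>y. y\<^sup>2"]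
      measurable_compose[OF Zs mq] qB mom(3,4) by (simp_all add: D_def)
  have iq: "integrable P (\<lambda>\<omega>. q (Z s \<omega>))"
    by (rule integrable_const_bound[of _ "(\<bar>\<mu>\<bar> + 1) * B + \<eta>"]) (use qB in auto)
  note int = integrable_bounded_of_Z[OF st(1)]
  \<comment> \<open>The second order expansion with \<open>\<xi>\<^sup>2\<close> multiplied out, so that every term is a function of
    \<open>Z s\<close> times a power of the increment \<open>D\<close>.\<close>
  define lower where "lower \<omega> = F (Z s \<omega>) + \<mu> * \<delta> * u (Z s \<omega>) + \<sigma> * (u (Z s \<omega>) * D \<omega>)
      - (1 / \<sigma>\<^sup>2) * (\<mu>\<^sup>2 * \<delta>\<^sup>2 * q (Z s \<omega>) + 2 * \<mu> * \<delta> * \<sigma> * (q (Z s \<omega>) * D \<omega>) + \<sigma>\<^sup>2 * (q (Z s \<omega>) * (D \<omega>)\<^sup>2))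
      - (4 * C / \<sigma>\<^sup>2) * (\<mu> ^ 4 * \<delta> ^ 4 + \<sigma> ^ 4 * D \<omega> ^ 4)" for \<omega>
  have path: "lower \<omega> \<le> F (Z s \<omega> + (\<mu> * \<delta> + \<sigma> * D \<omega>))" for \<omega>
  proof -
    define z where "z = Z s \<omega>"
    define r where "r = \<mu> * \<delta> + \<sigma> * D \<omega>"
    have "F z + r * u z - 2 / \<sigma>\<^sup>2 * (r\<^sup>2 / 2 * (\<mu> * u z + G z + \<eta>) + C * r ^ 4 / 4) \<le> F (z + r)"
    proof (rule second_order_lower_bound[where q = "\<lambda>y. \<mu> * u y + G y"])
      show "- (2 / \<sigma>\<^sup>2) * m * (y - x) \<le> u y - u x"
        if "x \<le> y" "\<And>s. x \<le> s \<Longrightarrow> s \<le> y \<Longrightarrow> \<mu> * u s + G s \<le> m" for x y m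
        using that by (rule slope)
    qed (use F' assms(5,6) in simp_all)
    moreover have "2 / \<sigma>\<^sup>2 * (r\<^sup>2 / 2 * (\<mu> * u z + G z + \<eta>) + C * r ^ 4 / 4)
        = (1 / \<sigma>\<^sup>2) * (\<mu>\<^sup>2 * \<delta>\<^sup>2 * q z + 2 * \<mu> * \<delta> * \<sigma> * (q z * D \<omega>) + \<sigma>\<^sup>2 * (q z * (D \<omega>)\<^sup>2))
          + (C / (2 * \<sigma>\<^sup>2)) * r ^ 4"
    proof -
      have split: "2 * i * (r\<^sup>2 / 2 * Q + C * r ^ 4 / 4) = i * (r\<^sup>2 * Q) + (C * i / 2) * r ^ 4" for i Q :: real
        by (simp add: algebra_simps)
      moreover have "r\<^sup>2 * q z = \<mu>\<^sup>2 * \<delta>\<^sup>2 * q z + 2 * \<mu> * \<delta> * \<sigma> * (q z * D \<omega>) + \<sigma>\<^sup>2 * (q z * (D \<omega>)\<^sup>2)"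
        by (simp add: r_def power2_sum algebra_simps power_mult_distrib)
      ultimately show ?thesis using split[of "1 / \<sigma>\<^sup>2" "q z"] by (simp add: q_def)
    qed
    moreover have "(C / (2 * \<sigma>\<^sup>2)) * r ^ 4 \<le> (C / (2 * \<sigma>\<^sup>2)) * (8 * ((\<mu> * \<delta>) ^ 4 + (\<sigma> * D \<omega>) ^ 4))"
      unfolding r_def using \<open>C \<ge> 0\<close> by (intro mult_left_mono power4_add_le) auto
    moreover have "(C / (2 * \<sigma>\<^sup>2)) * (8 * ((\<mu> * \<delta>) ^ 4 + (\<sigma> * D \<omega>) ^ 4))
        = (4 * C / \<sigma>\<^sup>2) * (\<mu> ^ 4 * \<delta> ^ 4 + \<sigma> ^ 4 * D \<omega> ^ 4)"
      using pos(1) by (simp add: power_mult_distrib field_simps)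
    moreover have "r * u z = \<mu> * \<delta> * u z + \<sigma> * (u z * D \<omega>)"
      by (simp add: r_def algebra_simps)
    moreover have "A + R1 + R2 - X - Y4 \<le> V"
      if "A + R - E \<le> V" "E = X + Y2" "Y2 \<le> Y3" "Y3 = Y4" "R = R1 + R2" for A R R1 R2 X Y2 Y3 Y4 E V :: real
      using that by linarith
    ultimately show ?thesis
      unfolding lower_def z_def[symmetric] r_def[symmetric] by blast
  qed
  have lower_int: "integrable P lower"
    unfolding lower_def using int uD qD qD2 iq mom by simp
  have "expectation (\<lambda>\<omega>. F (Z s \<omega>)) - \<delta> * expectation (\<lambda>\<omega>. G (Z s \<omega>)) - \<delta> * \<eta>
      - \<delta>\<^sup>2 * (\<mu>\<^sup>2 / \<sigma>\<^sup>2 * ((\<bar>\<mu>\<bar> + 1) * B + \<eta>) + 4 * C / \<sigma>\<^sup>2 * (\<mu> ^ 4 + 3 * \<sigma> ^ 4)) \<le> expectation lower"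
  proof -
    let ?Eq = "expectation (\<lambda>\<omega>. q (Z s \<omega>))"
    have "expectation lower = expectation (\<lambda>\<omega>. F (Z s \<omega>)) + \<mu> * \<delta> * expectation (\<lambda>\<omega>. u (Z s \<omega>))
       - (1 / \<sigma>\<^sup>2) * (\<mu>\<^sup>2 * \<delta>\<^sup>2 * ?Eq + \<sigma>\<^sup>2 * (?Eq * \<delta>))
       - (4 * C / \<sigma>\<^sup>2) * (\<mu> ^ 4 * \<delta> ^ 4 + \<sigma> ^ 4 * (3 * \<delta>\<^sup>2))"
      unfolding lower_def using int uD qD qD2 iq mom by (simp add: prob_space)
    moreover have "?Eq = \<mu> * expectation (\<lambda>\<omega>. u (Z s \<omega>)) + expectation (\<lambda>\<omega>. G (Z s \<omega>)) + \<eta>"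
      unfolding q_def using int by (simp add: prob_space)
    moreover have "(1 / \<sigma>\<^sup>2) * (\<mu>\<^sup>2 * \<delta>\<^sup>2 * ?Eq + \<sigma>\<^sup>2 * (?Eq * \<delta>)) = \<delta>\<^sup>2 * (\<mu>\<^sup>2 / \<sigma>\<^sup>2 * ?Eq) + ?Eq * \<delta>"
      using pos(1) by (simp add: field_simps)
    moreover have "\<delta>\<^sup>2 * (\<mu>\<^sup>2 / \<sigma>\<^sup>2 * ?Eq) \<le> \<delta>\<^sup>2 * (\<mu>\<^sup>2 / \<sigma>\<^sup>2 * ((\<bar>\<mu>\<bar> + 1) * B + \<eta>))"
    proof (intro mult_left_mono)
      have "q (Z s \<omega>) \<le> (\<bar>\<mu>\<bar> + 1) * B + \<eta>" for \<omega> using qB[of "Z s \<omega>"] by (rule abs_le_D1)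
      then show "?Eq \<le> (\<bar>\<mu>\<bar> + 1) * B + \<eta>" using iq by (intro integral_le_const) auto
    qed auto
    moreover have "(4 * C / \<sigma>\<^sup>2) * (\<mu> ^ 4 * \<delta> ^ 4 + \<sigma> ^ 4 * (3 * \<delta>\<^sup>2)) \<le> (4 * C / \<sigma>\<^sup>2) * (\<mu> ^ 4 * \<delta>\<^sup>2 + \<sigma> ^ 4 * (3 * \<delta>\<^sup>2))"
      using \<delta> \<open>C \<ge> 0\<close> by (intro mult_left_mono add_mono power_decreasing) auto
    moreover have "(4 * C / \<sigma>\<^sup>2) * (\<mu> ^ 4 * \<delta>\<^sup>2 + \<sigma> ^ 4 * (3 * \<delta>\<^sup>2)) = \<delta>\<^sup>2 * (4 * C / \<sigma>\<^sup>2 * (\<mu> ^ 4 + 3 * \<sigma> ^ 4))"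
      by (simp add: algebra_simps)
    ultimately show ?thesis by (simp add: algebra_simps)
  qed
  also have "\<dots> \<le> expectation (\<lambda>\<omega>. F (Z s \<omega> + (\<mu> * \<delta> + \<sigma> * D \<omega>)))"
  proof (rule integral_mono[OF lower_int _ path])
    show "integrable P (\<lambda>\<omega>. F (Z s \<omega> + (\<mu> * \<delta> + \<sigma> * D \<omega>)))"
      by (rule integrable_const_bound[of _ B]) (use bounded in \<open>auto simp: D_def\<close>)
  qed
  finally show ?thesis by (simp add: \<delta>_def D_def algebra_simps)
qed

text \<open>
  A control action consisting of an upward and a downward displacement costs at least the decrease of
  \<open>F\<close> that it causes, irrespective of how the two are interleaved in time.
\<close>

lemma jump_step:
  assumes "a \<ge> 0" "b \<ge> 0"
  shows "F z \<le> F (z + a - b) + (if a > 0 then K else 0) + (if b > 0 then L else 0) + k * a + l * b"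
proof -
  have "F z \<le> F (z + a) + (if a > 0 then K else 0) + k * a"
    using up[of z "z + a"] assms by (cases "a = 0") auto
  moreover have "F (z + a) \<le> F (z + a - b) + (if b > 0 then L else 0) + l * b"
    using down[of "z + a - b" "z + a"] assms by (cases "b = 0") auto
  ultimately show ?thesis by simp
qed

text \<open>
  A lower bound for the control cost incurred during \<open>(s, t]\<close>: at most one fixed cost is charged for
  each of the two controls.
\<close>

definition control_cost :: "real \<Rightarrow> real \<Rightarrow> 'a \<Rightarrow> real" where
  "control_cost s t \<omega> = K * (if Y1 s \<omega> < Y1 t \<omega> then 1 else 0) + L * (if Y2 s \<omega> < Y2 t \<omega> then 1 else 0)
     + k * (Y1 t \<omega> - Y1 s \<omega>) + l * (Y2 t \<omega> - Y2 s \<omega>)"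

lemma integrable_control_cost:
  assumes "0 \<le> s" "0 \<le> t"
  shows "integrable P (control_cost s t)"
proof -
  have [measurable]: "Y1 s \<in> borel_measurable P" "Y1 t \<in> borel_measurable P"
     "Y2 s \<in> borel_measurable P" "Y2 t \<in> borel_measurable P"
    using measurable_process assms by auto
  have "integrable P (\<lambda>\<omega>. if Y1 s \<omega> < Y1 t \<omega> then 1 else 0 :: real)"
    "integrable P (\<lambda>\<omega>. if Y2 s \<omega> < Y2 t \<omega> then 1 else 0 :: real)"
    by (rule integrable_const_bound[of _ 1]; simp)+
  then show ?thesis unfolding control_cost_def using integrable_control assms by simp
qed

definition mean_control :: "real \<Rightarrow> real" where
  "mean_control t = expectation (Y1 t) + expectation (Y2 t)"

text \<open>
  The truncation by \<open>max 0\<close> makes this a measurable function on the whole real line.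
\<close>

definition mean_G :: "real \<Rightarrow> real" where
  "mean_G r = expectation (\<lambda>\<omega>. G (Z (max 0 r) \<omega>))"

text \<open>
  The displacement of \<open>Z\<close> over \<open>[s, t]\<close> is the sum of an uncontrolled step from \<open>Z s\<close> and of the net
  control. Applying the control after the diffusion, instead of interleaving both, is legitimate because
  the jump inequalities hold at every starting point.
\<close>

lemma controlled_step:
  assumes st: "0 \<le> s" "s < t" "t - s \<le> 1" and "\<eta> > 0" "C \<ge> 0"
    and q: "\<And>y z. \<bar>(\<mu> * u y + G y) - (\<mu> * u z + G z)\<bar> \<le> \<eta> + C * (y - z)\<^sup>2"
  shows "expectation (\<lambda>\<omega>. F (Z s \<omega>)) \<le>
      expectation (\<lambda>\<omega>. F (Z t \<omega>)) + expectation (control_cost s t) + (t - s) * mean_G s + (t - s) * \<eta>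
      + (t - s)\<^sup>2 * (\<mu>\<^sup>2 / \<sigma>\<^sup>2 * ((\<bar>\<mu>\<bar> + 1) * B + \<eta>) + 4 * C / \<sigma>\<^sup>2 * (\<mu> ^ 4 + 3 * \<sigma> ^ 4))"
proof -
  have t: "0 \<le> t" using st by simp
  have [measurable]: "Z s \<in> borel_measurable P" "W s \<in> borel_measurable P" "W t \<in> borel_measurable P"
    using measurable_process st t by auto
  define V where "V \<omega> = Z s \<omega> + (\<mu> * (t - s) + \<sigma> * (W t \<omega> - W s \<omega>))" for \<omega>
  have "expectation (\<lambda>\<omega>. F (V \<omega>)) \<le> expectation (\<lambda>\<omega>. F (Z t \<omega>) + control_cost s t \<omega>)"
  proof (rule integral_mono)
    show "integrable P (\<lambda>\<omega>. F (V \<omega>))"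
      by (rule integrable_const_bound[of _ B]) (use bounded in \<open>auto simp: V_def\<close>)
    show "integrable P (\<lambda>\<omega>. F (Z t \<omega>) + control_cost s t \<omega>)"
      using integrable_bounded_of_Z[OF t] integrable_control_cost[OF st(1) t] by simp
    fix \<omega> assume \<omega>: "\<omega> \<in> space P"
    have "V \<omega> + (Y1 t \<omega> - Y1 s \<omega>) - (Y2 t \<omega> - Y2 s \<omega>) = Z t \<omega>"
      by (simp add: V_def Z_eq algebra_simps)
    then show "F (V \<omega>) \<le> F (Z t \<omega>) + control_cost s t \<omega>"
      using jump_step[of "Y1 t \<omega> - Y1 s \<omega>" "Y2 t \<omega> - Y2 s \<omega>" "V \<omega>"] control_mono[OF \<omega> st(1), of t] st
      by (auto simp: control_cost_def)
  qed
  also have "\<dots> = expectation (\<lambda>\<omega>. F (Z t \<omega>)) + expectation (control_cost s t)"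
    using integrable_bounded_of_Z[OF t] integrable_control_cost[OF st(1) t] by simp
  finally show ?thesis
    using diffusion_step[OF assms] st(1) unfolding V_def mean_G_def by simp
qed

text \<open>
  Why \<open>E G (Z s)\<close> may stand for \<open>E G (Z r)\<close> with \<open>r \<in> [s, t]\<close>. The error depends on the control only through
  its mean increment over \<open>[s, t]\<close>, which telescopes when summed over a grid.
\<close>

lemma mean_G_modulus:
  assumes st: "0 \<le> s" "s \<le> r" "r \<le> t" "t - s \<le> 1" and "\<eta> > 0" "C \<ge> 0"
    and G: "\<And>y z. \<bar>G y - G z\<bar> \<le> \<eta> + C * \<bar>y - z\<bar>"
  shows "mean_G s - (2 * \<eta> + (C * \<bar>\<mu>\<bar> + (C * \<sigma>)\<^sup>2 / \<eta>) * (t - s) + C * (mean_control t - mean_control s)) \<le> mean_G r"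
proof -
  have r: "0 \<le> r" using st by simp
  define D where "D = (\<lambda>\<omega>. W r \<omega> - W s \<omega>)"
  have D2: "integrable P (\<lambda>\<omega>. (D \<omega>)\<^sup>2)" "expectation (\<lambda>\<omega>. (D \<omega>)\<^sup>2) = r - s"
    using increment_moments(3,4)[of s r] st by (cases "s = r"; simp add: D_def)+
  have ic: "integrable P (Y1 r)" "integrable P (Y1 s)" "integrable P (Y2 r)" "integrable P (Y2 s)"
    using integrable_control r st by auto
  have "mean_G s - mean_G r = expectation (\<lambda>\<omega>. G (Z s \<omega>) - G (Z r \<omega>))"
    using integrable_bounded_of_Z r st by (simp add: mean_G_def)
  also have "\<dots> \<le> expectation (\<lambda>\<omega>. 2 * \<eta> + C * (\<bar>\<mu>\<bar> * (r - s)) + (C * \<sigma>)\<^sup>2 / \<eta> * (D \<omega>)\<^sup>2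
      + C * (Y1 r \<omega> - Y1 s \<omega> + (Y2 r \<omega> - Y2 s \<omega>)))"
  proof (rule integral_mono)
    fix \<omega> assume \<omega>: "\<omega> \<in> space P"
    have y: "0 \<le> Y1 r \<omega> - Y1 s \<omega>" "0 \<le> Y2 r \<omega> - Y2 s \<omega>" using control_mono[OF \<omega> st(1,2)] by auto
    have "\<bar>\<mu> * (r - s)\<bar> = \<bar>\<mu>\<bar> * (r - s)" "\<bar>\<sigma> * D \<omega>\<bar> = \<sigma> * \<bar>D \<omega>\<bar>"
      using st pos(1) by (simp_all add: abs_mult)
    moreover have "Z s \<omega> - Z r \<omega> = - (\<mu> * (r - s)) - \<sigma> * D \<omega> - (Y1 r \<omega> - Y1 s \<omega>) + (Y2 r \<omega> - Y2 s \<omega>)"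
      by (simp add: Z_eq D_def algebra_simps)
    ultimately have "\<bar>Z s \<omega> - Z r \<omega>\<bar> \<le> \<bar>\<mu>\<bar> * (r - s) + \<sigma> * \<bar>D \<omega>\<bar> + (Y1 r \<omega> - Y1 s \<omega> + (Y2 r \<omega> - Y2 s \<omega>))"
      using y by linarith
    then have "C * \<bar>Z s \<omega> - Z r \<omega>\<bar>
        \<le> C * (\<bar>\<mu>\<bar> * (r - s) + \<sigma> * \<bar>D \<omega>\<bar> + (Y1 r \<omega> - Y1 s \<omega> + (Y2 r \<omega> - Y2 s \<omega>)))"
      using \<open>C \<ge> 0\<close> by (rule mult_left_mono)
    also have "\<dots> = C * (\<bar>\<mu>\<bar> * (r - s)) + (C * \<sigma>) * \<bar>D \<omega>\<bar> + C * (Y1 r \<omega> - Y1 s \<omega> + (Y2 r \<omega> - Y2 s \<omega>))"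
      by (simp add: algebra_simps)
    finally show "G (Z s \<omega>) - G (Z r \<omega>) \<le> 2 * \<eta> + C * (\<bar>\<mu>\<bar> * (r - s)) + (C * \<sigma>)\<^sup>2 / \<eta> * (D \<omega>)\<^sup>2
      + C * (Y1 r \<omega> - Y1 s \<omega> + (Y2 r \<omega> - Y2 s \<omega>))"
      using G[of "Z s \<omega>" "Z r \<omega>"] linear_le_quadratic[OF \<open>\<eta> > 0\<close>, of "C * \<sigma>" "D \<omega>"] by linarith
  qed (use integrable_bounded_of_Z r st D2 ic in simp_all)
  also have "\<dots> = 2 * \<eta> + C * (\<bar>\<mu>\<bar> * (r - s)) + (C * \<sigma>)\<^sup>2 / \<eta> * (r - s) + C * (mean_control r - mean_control s)"
    using D2 ic by (simp add: prob_space mean_control_def)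
  also have "\<dots> \<le> 2 * \<eta> + C * (\<bar>\<mu>\<bar> * (t - s)) + (C * \<sigma>)\<^sup>2 / \<eta> * (t - s) + C * (mean_control t - mean_control s)"
    using st \<open>C \<ge> 0\<close> \<open>\<eta> > 0\<close> expectation_control_mono[OF r st(3)]
    by (intro add_mono mult_left_mono order_refl) (auto simp: mean_control_def)
  finally show ?thesis by (simp add: algebra_simps)
qed

end

section \<open>Summation over a grid and the cost over a finite horizon\<close>

lemma ennreal_add_le: "ennreal (a + b) \<le> ennreal a + ennreal b"
proof -
  have "ennreal (a + b) \<le> ennreal (max 0 a + max 0 b)" by (intro ennreal_leI) auto
  also have "\<dots> = ennreal a + ennreal b" by (subst ennreal_plus) (auto simp: ennreal_max_0)
  finally show ?thesis .
qed

lemma ennreal_integral_le_nn_integral: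
  assumes "integrable M f"
  shows "ennreal (\<integral>x. f x \<partial>M) \<le> (\<integral>\<^sup>+x. ennreal (f x) \<partial>M)"
proof -
  have "ennreal (\<integral>x. f x \<partial>M) \<le> ennreal (\<integral>x. max 0 (f x) \<partial>M)"
    using assms by (intro ennreal_leI integral_mono) auto
  also have "\<dots> = (\<integral>\<^sup>+x. ennreal (max 0 (f x)) \<partial>M)"
    using assms by (intro nn_integral_eq_integral[symmetric]) auto
  finally show ?thesis by (simp add: ennreal_max_0)
qed

context verification
begin

lemma Fubini_G:
  assumes "S \<in> sets lborel" "emeasure lborel S < \<infinity>"
  shows "integrable P (\<lambda>\<omega>. LBINT r:S. G (Z (max 0 r) \<omega>))"
    "expectation (\<lambda>\<omega>. LBINT r:S. G (Z (max 0 r) \<omega>)) = (LBINT r:S. mean_G r)"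
    "set_integrable lborel S mean_G"
proof -
  interpret pair_sigma_finite P lborel ..
  define f where "f \<omega> r = indicator S r *\<^sub>R G (Z (max 0 r) \<omega>)" for \<omega> r
  have [measurable]: "S \<in> sets borel" using assms by simp
  have "(\<lambda>x. G (case x of (\<omega>, r) \<Rightarrow> Z (max 0 r) \<omega>)) \<in> borel_measurable (P \<Otimes>\<^sub>M lborel)"
    by (rule measurable_compose[OF measurable_Z_pair borel_functions(3)])
  then have m: "case_prod f \<in> borel_measurable (P \<Otimes>\<^sub>M lborel)"
    unfolding f_def by (simp add: case_prod_unfold)
  have int: "integrable (P \<Otimes>\<^sub>M lborel) (case_prod f)"
  proof (rule integrableI_bounded_set[where A = "space P \<times> S" and B = B])
    show "emeasure (P \<Otimes>\<^sub>M lborel) (space P \<times> S) < \<infinity>"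
      using assms by (simp add: lborel.emeasure_pair_measure_Times emeasure_space_1)
  qed (use m bounded(3) in \<open>auto simp: f_def space_pair_measure indicator_def intro!: AE_I2 split: if_splits\<close>)
  show "integrable P (\<lambda>\<omega>. LBINT r:S. G (Z (max 0 r) \<omega>))"
    using integrable_fst[OF int] by (simp add: f_def set_lebesgue_integral_def)
  have "(\<integral>r. expectation (\<lambda>\<omega>. f \<omega> r) \<partial>lborel) = expectation (\<lambda>\<omega>. \<integral>r. f \<omega> r \<partial>lborel)"
    by (rule Fubini_integral[OF int])
  then show "expectation (\<lambda>\<omega>. LBINT r:S. G (Z (max 0 r) \<omega>)) = (LBINT r:S. mean_G r)"
    by (simp add: f_def set_lebesgue_integral_def mean_G_def)
  show "set_integrable lborel S mean_G"
    using integrable_snd[OF int] by (simp add: f_def set_integrable_def mean_G_def)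
qed

lemma mean_control_mono: "0 \<le> s \<Longrightarrow> s \<le> t \<Longrightarrow> mean_control s \<le> mean_control t"
  using expectation_control_mono by (auto simp: mean_control_def intro: add_mono)

lemma mean_control_nonneg: "0 \<le> t \<Longrightarrow> 0 \<le> mean_control t"
  using control_nonneg unfolding mean_control_def by (intro add_nonneg_nonneg integral_nonneg_AE) auto

text \<open>
  The quadratic form of the modulus: in the second order expansion it is multiplied by \<open>\<xi>\<^sup>2\<close>, and the
  result then has an expectation of the form \<open>\<eta> * O(\<delta>) + O(\<delta>\<^sup>2)\<close>.
\<close>

lemma drift_modulus:
  assumes "\<eta> > 0"
  shows "\<exists>C\<ge>0. \<forall>y z. \<bar>(\<mu> * u y + G y) - (\<mu> * u z + G z)\<bar> \<le> \<eta> + C * (y - z)\<^sup>2"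
proof -
  define \<eta>' where "\<eta>' = \<eta> / (2 * (\<bar>\<mu>\<bar> + 1))"
  have \<eta>': "\<eta>' > 0" "(\<bar>\<mu>\<bar> + 1) * \<eta>' = \<eta> / 2" using assms by (auto simp: \<eta>'_def field_simps)
  obtain C1 where C1: "\<And>y z. \<bar>u y - u z\<bar> \<le> \<eta>' + C1 * \<bar>y - z\<bar>" using modulus(1)[OF \<eta>'(1)] by blast
  obtain C2 where C2: "\<And>y z. \<bar>G y - G z\<bar> \<le> \<eta>' + C2 * \<bar>y - z\<bar>" using modulus(2)[OF \<eta>'(1)] by blast
  define C where "C = \<bar>\<mu>\<bar> * C1 + C2"
  have "\<bar>(\<mu> * u y + G y) - (\<mu> * u z + G z)\<bar> \<le> \<eta> + (C\<^sup>2 / (\<eta> / 2)) * (y - z)\<^sup>2" for y z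
  proof -
    have "(\<mu> * u y + G y) - (\<mu> * u z + G z) = \<mu> * (u y - u z) + (G y - G z)" by (simp add: algebra_simps)
    also have "\<bar>\<dots>\<bar> \<le> \<bar>\<mu>\<bar> * \<bar>u y - u z\<bar> + \<bar>G y - G z\<bar>"
      unfolding abs_mult[symmetric] by (rule abs_triangle_ineq)
    also have "\<dots> \<le> \<bar>\<mu>\<bar> * (\<eta>' + C1 * \<bar>y - z\<bar>) + (\<eta>' + C2 * \<bar>y - z\<bar>)"
      using C1 C2 by (intro add_mono mult_left_mono) auto
    also have "\<dots> = \<eta> / 2 + C * \<bar>y - z\<bar>"
      using \<eta>'(2) by (simp add: C_def algebra_simps)
    also have "C * \<bar>y - z\<bar> \<le> \<eta> / 2 + C\<^sup>2 / (\<eta> / 2) * (y - z)\<^sup>2"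
      using assms by (intro linear_le_quadratic) simp
    finally show ?thesis by simp
  qed
  moreover have "C\<^sup>2 / (\<eta> / 2) \<ge> 0" using assms by simp
  ultimately show ?thesis by blast
qed

text \<open>
  The error has the form \<open>(t - s) * 3 * \<eta>\<close> plus terms that vanish with the mesh when summed over a grid; \<open>C\<close> depends on \<open>\<eta>\<close>
  but not on the interval.
\<close>

lemma short_time_inequality:
  assumes "\<eta> > 0"
  shows "\<exists>C\<ge>0. \<forall>s t. 0 \<le> s \<longrightarrow> s < t \<longrightarrow> t - s \<le> 1 \<longrightarrow>
     expectation (\<lambda>\<omega>. F (Z s \<omega>)) \<le> expectation (\<lambda>\<omega>. F (Z t \<omega>)) + expectation (control_cost s t)
       + (LBINT r:{s..<t}. mean_G r) + (t - s) * (3 * \<eta> + C * ((t - s) + (mean_control t - mean_control s)))"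
proof -
  obtain C1 where C1: "C1 \<ge> 0" "\<And>y z. \<bar>(\<mu> * u y + G y) - (\<mu> * u z + G z)\<bar> \<le> \<eta> + C1 * (y - z)\<^sup>2"
    using drift_modulus[OF assms] by blast
  obtain C2 where C2: "C2 \<ge> 0" "\<And>y z. \<bar>G y - G z\<bar> \<le> \<eta> + C2 * \<bar>y - z\<bar>"
    using modulus(2)[OF assms] by blast
  define D1 where "D1 = \<mu>\<^sup>2 / \<sigma>\<^sup>2 * ((\<bar>\<mu>\<bar> + 1) * B + \<eta>) + 4 * C1 / \<sigma>\<^sup>2 * (\<mu> ^ 4 + 3 * \<sigma> ^ 4)"
  define D2 where "D2 = C2 * \<bar>\<mu>\<bar> + (C2 * \<sigma>)\<^sup>2 / \<eta>"
  define C where "C = \<bar>D1\<bar> + D2 + C2"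
  have D2: "D2 \<ge> 0" using C2(1) assms by (simp add: D2_def)
  have "expectation (\<lambda>\<omega>. F (Z s \<omega>)) \<le> expectation (\<lambda>\<omega>. F (Z t \<omega>)) + expectation (control_cost s t)
       + (LBINT r:{s..<t}. mean_G r) + (t - s) * (3 * \<eta> + C * ((t - s) + (mean_control t - mean_control s)))"
    if st: "0 \<le> s" "s < t" "t - s \<le> 1" for s t
  proof -
    define \<delta> where "\<delta> = t - s"
    define m where "m = mean_control t - mean_control s"
    define a where "a = mean_G s - (2 * \<eta> + D2 * \<delta> + C2 * m)"
    have \<delta>: "\<delta> > 0" and m: "m \<ge> 0" using st mean_control_mono[of s t] by (auto simp: \<delta>_def m_def)
    have fin: "emeasure lborel {s..<t} < \<infinity>" using st by simp
    have "\<delta> * a = (LBINT r:{s..<t}. a)"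
      using st by (simp add: set_lebesgue_integral_def \<delta>_def)
    also have "\<dots> \<le> (LBINT r:{s..<t}. mean_G r)"
    proof (rule set_integral_mono)
      show "set_integrable lborel {s..<t} (\<lambda>r. a)" using fin by (simp add: set_integrable_def)
      show "set_integrable lborel {s..<t} mean_G" by (rule Fubini_G(3)[OF _ fin]) simp
      fix r assume "r \<in> {s..<t}"
      then show "a \<le> mean_G r"
        using mean_G_modulus[OF st(1) _ _ st(3) assms C2, of r] by (simp add: a_def D2_def \<delta>_def m_def)
    qed
    finally have "\<delta> * mean_G s \<le> (LBINT r:{s..<t}. mean_G r) + \<delta> * (2 * \<eta> + D2 * \<delta> + C2 * m)"
      by (simp add: a_def algebra_simps)
    moreover have "expectation (\<lambda>\<omega>. F (Z s \<omega>)) \<le> expectation (\<lambda>\<omega>. F (Z t \<omega>)) + expectation (control_cost s t)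
        + \<delta> * mean_G s + \<delta> * \<eta> + \<delta>\<^sup>2 * D1"
      using controlled_step[OF st assms C1] by (simp add: \<delta>_def D1_def)
    moreover have "\<delta> * (2 * \<eta> + D2 * \<delta> + C2 * m) + \<delta> * \<eta> + \<delta>\<^sup>2 * D1 \<le> \<delta> * (3 * \<eta> + C * (\<delta> + m))"
    proof -
      have "D1 * \<delta> \<le> \<bar>D1\<bar> * \<delta>" using \<delta> by (intro mult_right_mono) auto
      moreover have "0 \<le> \<bar>D1\<bar> * m" "0 \<le> D2 * m" "0 \<le> C2 * \<delta>" using m \<delta> C2(1) D2 by simp_all
      ultimately have "2 * \<eta> + D2 * \<delta> + C2 * m + \<eta> + D1 * \<delta> \<le> 3 * \<eta> + C * (\<delta> + m)"
        by (simp add: C_def algebra_simps)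
      then have "\<delta> * (2 * \<eta> + D2 * \<delta> + C2 * m + \<eta> + D1 * \<delta>) \<le> \<delta> * (3 * \<eta> + C * (\<delta> + m))"
        using \<delta> by (intro mult_left_mono) auto
      then show ?thesis by (simp add: algebra_simps power2_eq_square)
    qed
    ultimately show ?thesis unfolding \<delta>_def[symmetric] m_def[symmetric] by linarith
  qed
  moreover have "C \<ge> 0" using D2 C2(1) by (simp add: C_def)
  ultimately show ?thesis by blast
qed

text \<open>
  The control cost up to time \<open>n * \<delta>\<close> as seen on the grid. It underestimates the true one, by
  \<open>active_intervals_le_num_increasing\<close>.
\<close>

definition discrete_cost :: "real \<Rightarrow> nat \<Rightarrow> 'a \<Rightarrow> real" where
  "discrete_cost \<delta> n \<omega> = K * active_intervals (\<lambda>s. Y1 s \<omega>) \<delta> n + L * active_intervals (\<lambda>s. Y2 s \<omega>) \<delta> n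
     + k * Y1 (real n * \<delta>) \<omega> + l * Y2 (real n * \<delta>) \<omega>"

lemma discrete_cost_Suc:
  "discrete_cost \<delta> (Suc n) \<omega> = discrete_cost \<delta> n \<omega> + control_cost (real n * \<delta>) (real (Suc n) * \<delta>) \<omega>"
  unfolding discrete_cost_def control_cost_def active_intervals_def by (simp add: algebra_simps)

lemma integrable_discrete_cost:
  assumes "\<delta> \<ge> 0"
  shows "integrable P (discrete_cost \<delta> n)"
proof (induction n)
  case 0
  have [measurable]: "Y1 0 \<in> borel_measurable P" "Y2 0 \<in> borel_measurable P"
    using measurable_process by auto
  have "integrable P (\<lambda>\<omega>. if Y1 0 \<omega> > 0 then 1 else 0 :: real)"
    "integrable P (\<lambda>\<omega>. if Y2 0 \<omega> > 0 then 1 else 0 :: real)"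
    by (rule integrable_const_bound[of _ 1]; simp)+
  then show ?case
    using integrable_control[of 0] by (simp add: discrete_cost_def active_intervals_def)
next
  case (Suc n)
  then show ?case
    unfolding discrete_cost_Suc[abs_def] using assms by (intro Bochner_Integration.integrable_add integrable_control_cost) auto
qed

text \<open>
  The jump at time \<open>0\<close> leads from \<open>x\<close> to \<open>Z 0\<close> almost surely; the mesh \<open>\<delta>\<close> is immaterial.
\<close>

lemma initial_jump: "F x \<le> expectation (\<lambda>\<omega>. F (Z 0 \<omega>)) + expectation (discrete_cost \<delta> 0)"
proof -
  have int: "integrable P (discrete_cost \<delta> 0)" "integrable P (\<lambda>\<omega>. F (Z 0 \<omega>))"
    using integrable_discrete_cost[of 0 0] integrable_bounded_of_Z[of 0]
    by (simp_all add: discrete_cost_def[abs_def] active_intervals_def)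
  have "expectation (\<lambda>\<omega>. F x) \<le> expectation (\<lambda>\<omega>. F (Z 0 \<omega>) + discrete_cost \<delta> 0 \<omega>)"
  proof (rule integral_mono_AE)
    have "AE \<omega> in P. W 0 \<omega> = 0" using BM by (simp add: standard_BM_def)
    then show "AE \<omega> in P. F x \<le> F (Z 0 \<omega>) + discrete_cost \<delta> 0 \<omega>"
      using AE_space
    proof eventually_elim
      case (elim \<omega>)
      then show ?case
        using jump_step[OF control_nonneg[OF elim(2) order_refl], of x]
        by (simp add: Z_eq discrete_cost_def active_intervals_def split: if_splits)
    qed
  qed (use int in simp_all)
  then show ?thesis using int by (simp add: prob_space)
qed

text \<open>
  The errors of \<open>n\<close> steps add up: the term \<open>\<delta>\<^sup>2\<close> to \<open>\<delta>\<close> times the elapsed time, and the increments of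
  \<open>mean_control\<close>, each weighted with \<open>\<delta>\<close>, by telescoping.
\<close>

lemma discretised_inequality:
  assumes "\<delta> > 0" "\<delta> \<le> 1"
    and C: "C \<ge> 0" "\<And>s t. 0 \<le> s \<Longrightarrow> s < t \<Longrightarrow> t - s \<le> 1 \<Longrightarrow>
     expectation (\<lambda>\<omega>. F (Z s \<omega>)) \<le> expectation (\<lambda>\<omega>. F (Z t \<omega>)) + expectation (control_cost s t)
       + (LBINT r:{s..<t}. mean_G r) + (t - s) * (3 * \<eta> + C * ((t - s) + (mean_control t - mean_control s)))"
  shows "F x \<le> expectation (\<lambda>\<omega>. F (Z (real n * \<delta>) \<omega>)) + expectation (discrete_cost \<delta> n)
     + (LBINT r:{0..<real n * \<delta>}. mean_G r)
     + 3 * \<eta> * (real n * \<delta>) + C * \<delta> * (real n * \<delta> + mean_control (real n * \<delta>))"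
proof (induction n)
  case 0
  have "0 \<le> C * \<delta> * mean_control 0" using assms mean_control_nonneg[of 0] by simp
  then show ?case using initial_jump[of \<delta>] by (simp add: set_lebesgue_integral_def)
next
  case (Suc n)
  let ?s = "real n * \<delta>" and ?t = "real (Suc n) * \<delta>"
  have st: "0 \<le> ?s" "?s < ?t" "?t - ?s = \<delta>" using assms by (auto simp: algebra_simps)
  have "expectation (\<lambda>\<omega>. F (Z ?s \<omega>)) \<le> expectation (\<lambda>\<omega>. F (Z ?t \<omega>)) + expectation (control_cost ?s ?t)
       + (LBINT r:{?s..<?t}. mean_G r) + \<delta> * (3 * \<eta> + C * (\<delta> + (mean_control ?t - mean_control ?s)))"
    by (rule C(2)[OF st(1,2), unfolded st(3), OF assms(2)])
  moreover have "expectation (discrete_cost \<delta> (Suc n)) = expectation (discrete_cost \<delta> n) + expectation (control_cost ?s ?t)"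
    unfolding discrete_cost_Suc[abs_def]
    using integrable_discrete_cost integrable_control_cost[of ?s ?t] st assms by simp
  moreover have "(LBINT r:{0..<?t}. mean_G r) = (LBINT r:{0..<?s}. mean_G r) + (LBINT r:{?s..<?t}. mean_G r)"
  proof -
    have "{0..<?t} = {0..<?s} \<union> {?s..<?t}" using st by (intro ivl_disj_un(17)[symmetric]) auto
    then show ?thesis
      using Fubini_G(3)[of "{0..<?s}"] Fubini_G(3)[of "{?s..<?t}"] st by (simp add: set_integral_Un)
  qed
  moreover have "\<delta> * (3 * \<eta> + C * (\<delta> + (mean_control ?t - mean_control ?s)))
      = (3 * \<eta> * ?t + C * \<delta> * (?t + mean_control ?t)) - (3 * \<eta> * ?s + C * \<delta> * (?s + mean_control ?s))"
    by (simp add: algebra_simps)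
  ultimately show ?case using Suc by linarith
qed

text \<open>
  Take \<open>\<eta>\<close> small and then the mesh \<open>T / n\<close> small in terms of the resulting \<open>C\<close>.
\<close>

lemma verification_inequality:
  assumes "T > 0" "e > 0"
  shows "\<exists>n>0. F x - e \<le> expectation (\<lambda>\<omega>. F (Z T \<omega>)) + expectation (discrete_cost (T / real n) n)
     + expectation (\<lambda>\<omega>. LBINT r:{0..<T}. G (Z (max 0 r) \<omega>))"
proof -
  define \<eta> where "\<eta> = e / (6 * T)"
  have \<eta>: "\<eta> > 0" "3 * \<eta> * T = e / 2" using assms by (auto simp: \<eta>_def)
  obtain C where C: "C \<ge> 0" "\<And>s t. 0 \<le> s \<Longrightarrow> s < t \<Longrightarrow> t - s \<le> 1 \<Longrightarrow>
     expectation (\<lambda>\<omega>. F (Z s \<omega>)) \<le> expectation (\<lambda>\<omega>. F (Z t \<omega>)) + expectation (control_cost s t)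
       + (LBINT r:{s..<t}. mean_G r) + (t - s) * (3 * \<eta> + C * ((t - s) + (mean_control t - mean_control s)))"
    using short_time_inequality[OF \<eta>(1)] by blast
  define A where "A = C * (T + mean_control T)"
  have "A \<ge> 0" using C(1) assms mean_control_nonneg[of T] by (simp add: A_def)
  obtain n :: nat where n: "real n > max T (2 * A * T / e)" using reals_Archimedean2 by blast
  then have n0: "real n > 0" "n > 0" "T < real n" "2 * A * T / e < real n" using assms by auto
  define \<delta> where "\<delta> = T / real n"
  have \<delta>: "\<delta> > 0" "\<delta> \<le> 1" "real n * \<delta> = T" using n0 assms by (auto simp: \<delta>_def)
  have "A * \<delta> \<le> e / 2" using n0 assms by (simp add: \<delta>_def field_simps)
  then have "C * \<delta> * (T + mean_control T) \<le> e / 2" by (simp add: A_def mult_ac)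
  then have "F x - e \<le> expectation (\<lambda>\<omega>. F (Z T \<omega>)) + expectation (discrete_cost \<delta> n) + (LBINT r:{0..<T}. mean_G r)"
    using discretised_inequality[OF \<delta>(1,2) C, of n] \<eta>(2) unfolding \<delta>(3) by linarith
  then show ?thesis
    using n0(2) Fubini_G(2)[of "{0..<T}"] assms by (intro exI[of _ n]) (simp add: \<delta>_def)
qed

text \<open>
  As \<open>F\<close> is bounded by \<open>B\<close>, its terminal value costs only a constant. To bypass
  the measurability of the number of increasing points, the cost is compared pointwise with the integrable
  grid cost \<open>R\<close> before taking expectations.
\<close>

lemma expected_cost_lower_bound:
  assumes "T > 0" and h: "\<And>z. c + G z \<le> h z"
  shows "ereal (c * T + F x - B) \<le> enn2ereal
     (\<integral>\<^sup>+\<omega>. (\<integral>\<^sup>+s\<in>{0..T}. ennreal (h (Z s \<omega>)) \<partial>lborel)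
          + ennreal K * num_increasing (\<lambda>s. Y1 s \<omega>) T + ennreal L * num_increasing (\<lambda>s. Y2 s \<omega>) T
          + ennreal (k * Y1 T \<omega>) + ennreal (l * Y2 T \<omega>) \<partial>P)" (is "_ \<le> enn2ereal (\<integral>\<^sup>+\<omega>. ?cost \<omega> \<partial>P)")
proof (rule ereal_le_epsilon2)
  fix e :: real assume "e > 0"
  define J where "J \<omega> = (LBINT r:{0..<T}. G (Z (max 0 r) \<omega>))" for \<omega>
  obtain n where n: "n > 0" "F x - e \<le> expectation (\<lambda>\<omega>. F (Z T \<omega>)) + expectation (discrete_cost (T / real n) n) + expectation J"
    using verification_inequality[OF \<open>T > 0\<close> \<open>e > 0\<close>] unfolding J_def by blast
  define \<delta> where "\<delta> = T / real n"
  have \<delta>: "\<delta> > 0" "real n * \<delta> = T" using n(1) \<open>T > 0\<close> by (auto simp: \<delta>_def)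
  define R where "R \<omega> = (c * T + J \<omega>) + discrete_cost \<delta> n \<omega>" for \<omega>
  have fin: "emeasure lborel {0..<T} < \<infinity>" using \<open>T > 0\<close> by simp
  have intJ: "integrable P J" unfolding J_def[abs_def] by (rule Fubini_G(1)[OF _ fin]) simp
  have intR: "integrable P R"
    unfolding R_def[abs_def] using intJ integrable_discrete_cost[of \<delta> n] \<delta> by simp
  have "expectation (\<lambda>\<omega>. F (Z T \<omega>)) \<le> B"
    using integrable_bounded_of_Z(1)[of T] \<open>T > 0\<close> bounded(1) by (intro integral_le_const) (auto simp: abs_le_iff)
  then have lower: "c * T + F x - B - e \<le> expectation R"
    unfolding R_def[abs_def] using n(2) intJ integrable_discrete_cost[of \<delta> n] \<delta>
    by (simp add: prob_space \<delta>_def)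
  have "ennreal (expectation R) \<le> (\<integral>\<^sup>+\<omega>. ?cost \<omega> \<partial>P)"
  proof -
    have "ennreal (expectation R) \<le> (\<integral>\<^sup>+\<omega>. ennreal (R \<omega>) \<partial>P)"
      by (rule ennreal_integral_le_nn_integral[OF intR])
    also have "\<dots> \<le> (\<integral>\<^sup>+\<omega>. ?cost \<omega> \<partial>P)"
    proof (rule nn_integral_mono)
      fix \<omega> assume \<omega>: "\<omega> \<in> space P"
      have meas: "(\<lambda>r. G (Z (max 0 r) \<omega>)) \<in> borel_measurable lborel"
        using measurable_compose[OF measurable_Pair2[OF measurable_Z_pair \<omega>] borel_functions(3)] by simp
      have gen: "set_integrable lborel {0..<T} (\<lambda>r. c' + G (Z (max 0 r) \<omega>))" for c' :: real
        unfolding set_integrable_def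
      proof (rule integrableI_bounded_set[where A = "{0..<T}" and B = "\<bar>c'\<bar> + B"])
        have "\<bar>c' + G y\<bar> \<le> \<bar>c'\<bar> + B" for y
          using abs_triangle_ineq[of c' "G y"] bounded(3)[of y] by linarith
        then show "AE r in lborel. r \<in> {0..<T} \<longrightarrow>
            norm (indicat_real {0..<T} r *\<^sub>R (c' + G (Z (max 0 r) \<omega>))) \<le> \<bar>c'\<bar> + B"
          by (intro AE_I2) simp
      qed (use meas fin in auto)
      note int = gen[of c] gen[of 0, simplified]
      have "c * T + J \<omega> = (LBINT r:{0..<T}. c + G (Z (max 0 r) \<omega>))"
        using int(2) \<open>T > 0\<close> by (subst set_integral_add) (auto simp: J_def set_lebesgue_integral_def set_integrable_def)
      then have "ennreal (c * T + J \<omega>) \<le> (\<integral>\<^sup>+r. ennreal (indicator {0..<T} r *\<^sub>R (c + G (Z (max 0 r) \<omega>))) \<partial>lborel)"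
        using ennreal_integral_le_nn_integral[OF int(1)[unfolded set_integrable_def]]
        by (simp add: set_lebesgue_integral_def)
      also have "\<dots> \<le> (\<integral>\<^sup>+s\<in>{0..T}. ennreal (h (Z s \<omega>)) \<partial>lborel)"
        using h by (intro nn_integral_mono) (auto split: split_indicator intro: ennreal_leI)
      finally have 1: "ennreal (c * T + J \<omega>) \<le> (\<integral>\<^sup>+s\<in>{0..T}. ennreal (h (Z s \<omega>)) \<partial>lborel)" .
      have 2: "ennreal (active_intervals (\<lambda>s. Y1 s \<omega>) \<delta> n) \<le> num_increasing (\<lambda>s. Y1 s \<omega>) T"
        "ennreal (active_intervals (\<lambda>s. Y2 s \<omega>) \<delta> n) \<le> num_increasing (\<lambda>s. Y2 s \<omega>) T"
        using active_intervals_le_num_increasing[of "\<lambda>s. Y1 s \<omega>" \<delta> n] active_intervals_le_num_increasing[of "\<lambda>s. Y2 s \<omega>" \<delta> n]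
          control_path[OF \<omega>] \<delta> by simp_all
      have "ennreal (R \<omega>) \<le> ennreal (c * T + J \<omega>) + ennreal (K * active_intervals (\<lambda>s. Y1 s \<omega>) \<delta> n)
          + ennreal (L * active_intervals (\<lambda>s. Y2 s \<omega>) \<delta> n) + ennreal (k * Y1 T \<omega>) + ennreal (l * Y2 T \<omega>)"
      proof -
        have sum5: "ennreal (a1 + a2 + a3 + a4 + a5) \<le> ennreal a1 + ennreal a2 + ennreal a3 + ennreal a4 + ennreal a5"
          for a1 a2 a3 a4 a5 :: real
          by (intro order_trans[OF ennreal_add_le] add_right_mono order_refl)
        have "R \<omega> = (c * T + J \<omega>) + K * active_intervals (\<lambda>s. Y1 s \<omega>) \<delta> n
          + L * active_intervals (\<lambda>s. Y2 s \<omega>) \<delta> n + k * Y1 T \<omega> + l * Y2 T \<omega>"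
          unfolding R_def discrete_cost_def \<delta>(2) by simp
        then show ?thesis using sum5 by simp
      qed
      also have "\<dots> \<le> ?cost \<omega>"
        using 1 2 pos(2,3) by (intro add_mono order_refl) (auto simp: ennreal_mult' intro!: mult_left_mono)
      finally show "ennreal (R \<omega>) \<le> ?cost \<omega>" .
    qed
    finally show ?thesis .
  qed
  moreover have "ereal (expectation R) \<le> enn2ereal (ennreal (expectation R))"
    by (simp add: ennreal.rep_eq)
  moreover have "ereal (c * T + F x - B - e) \<le> ereal (expectation R)"
    using lower by simp
  ultimately have "ereal (c * T + F x - B - e) \<le> enn2ereal (\<integral>\<^sup>+\<omega>. ?cost \<omega> \<partial>P)"
    unfolding less_eq_ennreal.rep_eq by order
  then show "ereal (c * T + F x - B) \<le> enn2ereal (\<integral>\<^sup>+\<omega>. ?cost \<omega> \<partial>P) + ereal e"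
    by (cases "enn2ereal (\<integral>\<^sup>+\<omega>. ?cost \<omega> \<partial>P)") auto
qed

end

section \<open>The long-run average cost\<close>

theorem theorem4p1:
  fixes P :: "'a measure" and F :: "real \<Rightarrow> 'a measure" and W :: "real \<Rightarrow> 'a \<Rightarrow> real"
    and \<mu> \<sigma> K L k l \<gamma> M :: real and h f :: "real \<Rightarrow> real"
  assumes "\<sigma> > 0" "K \<ge> 0" "L \<ge> 0" "k > 0" "l > 0"
    and "filtered_prob_space P F"
    and "standard_BM P F W"
    and "holding_cost \<mu> \<sigma> h"
    and "f C1_differentiable_on UNIV"
    and "locally_abs_continuous (deriv f)"
    and "\<And>b c. deriv (deriv f) absolutely_integrable_on {b..c}"
    and "M > 0" "\<And>x. \<bar>deriv f x\<bar> \<le> M"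
    and "AE x in lborel. deriv f differentiable (at x) \<and> Gamma_op \<mu> \<sigma> f x + h x \<ge> \<gamma>"
    and "\<And>x y. y < x \<Longrightarrow> f y - f x \<le> K + k * (x - y)"
    and "\<And>x y. x < y \<Longrightarrow> f y - f x \<le> L + l * (y - x)"
  shows "\<forall>\<phi> x. feasible_policy P F K L \<phi> \<longrightarrow> AC P \<mu> \<sigma> W K L k l h x \<phi> \<ge> ereal \<gamma>"
proof (intro allI impI)
  fix \<phi> :: "'a policy" and x :: real
  assume feasible: "feasible_policy P F K L \<phi>"
  obtain Y1 Y2 where \<phi>: "\<phi> = (Y1, Y2)" by (cases \<phi>)
  interpret controlled_inventory P F W Y1 Y2 \<mu> \<sigma> x
    by standard (use assms(6,7) feasible in \<open>auto simp: feasible_policy_def is_policy_def \<phi>\<close>)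
  obtain D where D: "\<And>z. (f has_real_derivative D z) (at z)" "continuous_on UNIV D"
    using assms(9) by (auto simp: C1_differentiable_on_def has_real_derivative_iff_has_vector_derivative)
  have "deriv f = D" using D(1) by (intro ext DERIV_imp_deriv)
  then have f': "\<And>z. (f has_real_derivative deriv f z) (at z)" and cont_f': "continuous_on UNIV (deriv f)"
    using D by simp_all
  obtain R where R: "\<And>z. \<bar>z\<bar> \<ge> R \<Longrightarrow> \<gamma> \<le> h z"
    using holding_cost_coercive[OF assms(8)] by blast
  have cont_h: "continuous_on UNIV h" using assms(8) by (simp add: holding_cost_def)
  show "ereal \<gamma> \<le> AC P \<mu> \<sigma> W K L k l h x \<phi>"
  proof (rule ereal_le_epsilon2)
    fix \<epsilon> :: real assume "\<epsilon> > 0"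
    obtain Fb u G B where sol: "bounded_subsolution \<mu> \<sigma> K L k l Fb u G B"
      and Gh: "\<And>z. \<gamma> - \<epsilon> + G z \<le> h z"
      using ex_bounded_subsolution[OF assms(1-5) f' cont_f' _ assms(13-16) cont_h R \<open>\<epsilon> > 0\<close>]
        assms(10) unfolding locally_abs_continuous_def by blast
    interpret bounded_subsolution \<mu> \<sigma> K L k l Fb u G B by (rule sol)
    interpret verification P F W Y1 Y2 \<mu> \<sigma> x K L k l Fb u G B by unfold_locales
    \<comment> \<open>After division by \<open>t\<close> the bounded terms disappear in the limit.\<close>
    have "((\<lambda>t. ereal ((\<gamma> - \<epsilon>) + (Fb x - B) * (1 / t))) \<longlongrightarrow> ereal ((\<gamma> - \<epsilon>) + (Fb x - B) * 0)) at_top"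
      by (intro tendsto_intros tendsto_divide_0[OF tendsto_const] filterlim_at_top_imp_at_infinity filterlim_ident)
    then have "ereal (\<gamma> - \<epsilon>) = Limsup at_top (\<lambda>t. ereal ((\<gamma> - \<epsilon>) + (Fb x - B) * (1 / t)))"
      by (intro lim_imp_Limsup[symmetric]) auto
    also have "\<dots> \<le> AC P \<mu> \<sigma> W K L k l h x \<phi>"
      unfolding AC_def
    proof (rule Limsup_mono, rule eventually_mono[OF eventually_gt_at_top[of 0]])
      fix t :: real assume "t > 0"
      let ?C = "enn2ereal
       (\<integral>\<^sup>+\<omega>. (\<integral>\<^sup>+s\<in>{0..t}. ennreal (h (inventory \<mu> \<sigma> W x \<phi> s \<omega>)) \<partial>lborel)
          + ennreal K * num_increasing (\<lambda>s. fst \<phi> s \<omega>) t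
          + ennreal L * num_increasing (\<lambda>s. snd \<phi> s \<omega>) t
          + ennreal (k * fst \<phi> t \<omega>) + ennreal (l * snd \<phi> t \<omega>) \<partial>P)"
      have "ereal ((\<gamma> - \<epsilon>) + (Fb x - B) * (1 / t)) = ereal (1 / t) * ereal ((\<gamma> - \<epsilon>) * t + Fb x - B)"
        using \<open>t > 0\<close> by (simp add: field_simps)
      also have "\<dots> \<le> ereal (1 / t) * ?C"
        using expected_cost_lower_bound[OF \<open>t > 0\<close> Gh] \<open>t > 0\<close>
        by (intro ereal_mult_left_mono) (simp_all add: \<phi>)
      finally show "ereal ((\<gamma> - \<epsilon>) + (Fb x - B) * (1 / t)) \<le> ereal (1 / t) * ?C" .
    qed
    finally show "ereal \<gamma> \<le> AC P \<mu> \<sigma> W K L k l h x \<phi> + ereal \<epsilon>"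
      by (cases "AC P \<mu> \<sigma> W K L k l h x \<phi>") auto
  qed
qed

end
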